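(* Consider an additive orthogonal regression code with parameters $\{(c_l,\gamma_l)\}_{l=1}^L$ under distance-based greedy encoding, where the design matrix $A\in\mathbb{R}^{n\times N}$ has i.i.d. $\mathcal{N}(0,1)$ entries. Let $\sigma>0$. Then the deterministic centerings $D_0,\dots,D_L$ satisfy a recursion of the form $$D_0=\sigma^2,\qquad \sqrt{D_l}=\sqrt{D_{l-1}}\;\gamma_l\Big(n,\frac{c_l}{\sqrt{nD_{l-1}}}\Big)+\frac{\eta_l}{\sqrt n},\quad l=1,\dots,L,$$ where $|\eta_l|\le\big(\sum_{k=1}^{l-1}c_k^2\big)^{1/2}$.
   Context: $\|\cdot\|$ is the Euclidean norm; empty sums equal $0$. Additive orthogonal regression code: nonempty finite sets $\mathcal{B}_1,\dots,\mathcal{B}_L\subset\mathbb{R}^N$ that are mutually orthogonal ($\langle b,b'\rangle=0$ for $b\in\mathcal{B}_l$, $b'\in\mathcal{B}_{l'}$, $l\ne l'$), with $\|b\|=c_l$ for every $b\in\mathcal{B}_l$, where $c_l>0$ is a constant. The codebook is $\{A\beta: \beta\in\mathcal{B}_1+\cdots+\mathcal{B}_L\}\subset\mathbb{R}^n$. The function $\gamma_l:\mathbb{N}\times\mathbb{R}\to\mathbb{R}_+$ is $$\gamma_l(n,\lambda)=\mathbb{E}\Big[\min_{b\in\mathcal{B}_l}\Big\|e_1-\frac{\lambda}{\|b\|}Ab\Big\|\Big],$$ where $e_1\in\mathbb{R}^n$ is the first standard basis vector and $A\in\mathbb{R}^{n\times N}$ has i.i.d. $\mathcal{N}(0,1)$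 entries. Distance-based greedy encoding of a source vector $x\in\mathbb{R}^n$: set $\beta_0=0$, $r_0=x$, and for $l=1,\dots,L$, $$b_l\in\operatorname{arg\,min}_{b\in\mathcal{B}_l}\|r_{l-1}-Ab\|,\quad \beta_l=\beta_{l-1}+b_l,\quad r_l=x-A\beta_l,$$ with ties broken by a fixed measurable rule that is a function of $(r_{l-1},(Ab)_{b\in\mathcal{B}_l})$. Deterministic centering: $D_l=\frac1n\big(\mathbb{E}\|r_l\|\big)^2$, where the encoder is run on a deterministic source $x\in\mathbb{R}^n$ with $\|x\|=\sqrt n\,\sigma$, e.g. $x=\sqrt n\,\sigma e_1$ (the value does not depend on which such $x$ is used). *)

theory Defs
  imports "HOL-Probability.Probability"
begin

definition additive_orthogonal_code ::
    "nat \<Rightarrow> (nat \<Rightarrow> (real ^ 'N::finite) set) \<Rightarrow> (nat \<Rightarrow> real) \<Rightarrow> bool" where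
  "additive_orthogonal_code L B c \<longleftrightarrow>
     (\<forall>l\<in>{1..L}. finite (B l) \<and> B l \<noteq> {} \<and> c l > 0 \<and> (\<forall>b\<in>B l. norm b = c l)) \<and>
     (\<forall>l\<in>{1..L}. \<forall>l'\<in>{1..L}. l \<noteq> l' \<longrightarrow> (\<forall>b\<in>B l. \<forall>b'\<in>B l'. b \<bullet> b' = 0))"

(* A matrix with rows indexed by 'n and columns by 'N has type real ^ 'N ^ 'n. *)
definition iid_std_normal_matrix ::
    "'w measure \<Rightarrow> ('w \<Rightarrow> real ^ 'N::finite ^ 'n::finite) \<Rightarrow> bool" where
  "iid_std_normal_matrix M A \<longleftrightarrow> prob_space M \<and>
     prob_space.indep_vars M (\<lambda>_. borel) (\<lambda>(i, j) \<omega>. A \<omega> $ i $ j) UNIV \<and>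
     (\<forall>i j. distributed M lborel (\<lambda>\<omega>. A \<omega> $ i $ j) (\<lambda>t. ennreal (std_normal_density t)))"

(* The reference unit vector is the standard basis vector with index i. A finite index
   type carries no distinguished first element, so the index is a parameter.
   The dimension n is CARD('n). *)
definition code_gamma ::
    "'w measure \<Rightarrow> ('w \<Rightarrow> real ^ 'N::finite ^ 'n::finite) \<Rightarrow> 'n \<Rightarrow> (real ^ 'N) set \<Rightarrow> real \<Rightarrow> real" where
  "code_gamma M A i S lam =
     (\<integral>\<omega>. Min ((\<lambda>b. norm (axis i 1 - (lam / norm b) *\<^sub>R (A \<omega> *v b))) ` S) \<partial>M)"

(* A selection (arg min together with a measurable tie-breaking rule) sees only the residual r
   and the family y = (A b) indexed by b in S, represented as an extensional function on S. *)
definition distance_selection ::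
    "(real ^ 'N::finite) set \<Rightarrow>
     (real ^ 'n::finite \<Rightarrow> (real ^ 'N \<Rightarrow> real ^ 'n) \<Rightarrow> real ^ 'N) \<Rightarrow> bool" where
  "distance_selection S s \<longleftrightarrow>
     (\<forall>r. \<forall>y\<in>extensional S. is_arg_min (\<lambda>b. norm (r - y b)) (\<lambda>b. b \<in> S) (s r y)) \<and>
     (\<lambda>(r, y). s r y) \<in> measurable (borel \<Otimes>\<^sub>M PiM S (\<lambda>_. borel)) borel"

primrec greedy_beta ::
    "(nat \<Rightarrow> (real ^ 'N::finite) set) \<Rightarrow>
     (nat \<Rightarrow> real ^ 'n::finite \<Rightarrow> (real ^ 'N \<Rightarrow> real ^ 'n) \<Rightarrow> real ^ 'N) \<Rightarrow>
     real ^ 'n \<Rightarrow> real ^ 'N ^ 'n \<Rightarrow> nat \<Rightarrow> real ^ 'N" where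
  "greedy_beta B s x A 0 = 0"
| "greedy_beta B s x A (Suc l) = greedy_beta B s x A l +
     s (Suc l) (x - A *v greedy_beta B s x A l) (restrict (\<lambda>b. A *v b) (B (Suc l)))"

definition greedy_residual ::
    "(nat \<Rightarrow> (real ^ 'N::finite) set) \<Rightarrow>
     (nat \<Rightarrow> real ^ 'n::finite \<Rightarrow> (real ^ 'N \<Rightarrow> real ^ 'n) \<Rightarrow> real ^ 'N) \<Rightarrow>
     real ^ 'n \<Rightarrow> real ^ 'N ^ 'n \<Rightarrow> nat \<Rightarrow> real ^ 'n" where
  "greedy_residual B s x A l = x - A *v greedy_beta B s x A l"

definition deterministic_centering ::
    "'w measure \<Rightarrow> ('w \<Rightarrow> real ^ 'N::finite ^ 'n::finite) \<Rightarrow> (nat \<Rightarrow> (real ^ 'N) set) \<Rightarrow>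
     (nat \<Rightarrow> real ^ 'n \<Rightarrow> (real ^ 'N \<Rightarrow> real ^ 'n) \<Rightarrow> real ^ 'N) \<Rightarrow>
     real ^ 'n \<Rightarrow> nat \<Rightarrow> real" where
  "deterministic_centering M A B s x l =
     1 / real CARD('n) * (\<integral>\<omega>. norm (greedy_residual B s x (A \<omega>) l) \<partial>M)\<^sup>2"

end

(* Given r_{l-1}, the next residual norm is min_b ||r_{l-1} - A b|| with a fresh Gaussian matrix,
   because the blocks are orthogonal; by rotation invariance its conditional mean is
   g(||r_{l-1}||) with g(rho) = rho * gamma_l(n, c_l / rho), and g is 1-Lipschitz. So eta_l is
   E g(R) - g(E R) for R = ||r_{l-1}||, at most the standard deviation of R. The variance of R
   grows by at most c_l^2 per step: A -> min_b ||r - A b|| is c_l-Lipschitz, and the Gaussian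
   Poincare inequality bounds its variance by c_l^2. *)

theory Submission
  imports Defs
begin

section \<open>The Gaussian Poincare inequality\<close>

text \<open>Two obstacles shape the argument. The Poincare inequality is proved for differentiable
  functions, but a minimum of norms has kinks; the inequality is therefore applied to soft minima
  and carried over by Fatou's lemma. For this reason variances enter as the double integral
  \<open>sq_spread\<close>, the mean of \<open>(f X - f Y)\<^sup>2\<close> over independent
  \<open>X\<close> and \<open>Y\<close>: it involves no mean, needs no integrability, and suits
  Tonelli, Fatou and product measures. It is twice the variance, whence the factors 2 in the bounds.

  The other obstacle is conditioning on the residual, which depends on the matrix through all
  earlier selections. No conditional expectation is formed. Instead, two independent Gaussian
  matrices are mixed along an orthogonal projection into one of the same law, for which the earlier
  steps read only one of the two and the current step reads the other; Fubini then does the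
  conditioning.

  A separate point is that the mean residual norms are positive, so that the argument of gamma
  involves no division by zero.\<close>

abbreviation std_normal_measure :: "real measure" where
  "std_normal_measure \<equiv> density lborel (\<lambda>t. ennreal (std_normal_density t))"

definition sq_spread :: "'a measure \<Rightarrow> ('a \<Rightarrow> real) \<Rightarrow> ennreal" where
  "sq_spread M f = (\<integral>\<^sup>+x. \<integral>\<^sup>+y. ennreal ((f x - f y)\<^sup>2) \<partial>M \<partial>M)"

lemma prob_space_std_normal_measure: "prob_space std_normal_measure"
  by (rule prob_space_normal_density) simp

section \<open>One-dimensional Gaussian tail integrals and the Poincare inequality on the
  line\<close>

lemma has_real_derivative_std_normal_density:
  "(std_normal_density has_real_derivative - (t * std_normal_density t)) (at t)"
  unfolding std_normal_density_def [abs_def]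
  by (auto intro!: derivative_eq_intros simp: field_simps power2_eq_square)

text \<open>\<open>- std_normal_density\<close> is an antiderivative of the integrand and vanishes
  at infinity.\<close>

lemma integral_std_normal_upper_tail:
  "(\<integral>x. indicator {t..} x * (std_normal_density x * x) \<partial>lborel) = std_normal_density t"
proof -
  have i: "integrable lborel (\<lambda>x. std_normal_density x * x)"
    using integrable_std_normal_moment[of 1] by simp
  have "(LBINT x=ereal t..\<infinity>. std_normal_density x * x) = 0 - (- std_normal_density t)"
  proof (rule interval_integral_FTC_integrable)
    show "((\<lambda>x. - std_normal_density x) has_vector_derivative std_normal_density x * x) (at x)" for x
      using DERIV_minus[OF has_real_derivative_std_normal_density[of x]]
      by (simp add: has_real_derivative_iff_has_vector_derivative mult.commute)
    show "isCont (\<lambda>x. std_normal_density x * x) x" for x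
      unfolding std_normal_density_def by (intro continuous_intros) auto
    show "set_integrable lborel (einterval (ereal t) \<infinity>) (\<lambda>x. std_normal_density x * x)"
      unfolding set_integrable_def using integrable_mult_indicator[OF _ i, of "{t<..}"]
      by (simp add: einterval_def greaterThan_def)
    have "((\<lambda>x. - std_normal_density x) \<longlongrightarrow> - std_normal_density t) (at_right t)"
      using DERIV_isCont[OF DERIV_minus[OF has_real_derivative_std_normal_density[of t]]]
      by (simp add: isCont_def filterlim_at_split)
    then show "(((\<lambda>x. - std_normal_density x) \<circ> real_of_ereal) \<longlongrightarrow> - std_normal_density t) (at_right (ereal t))"
      by (simp add: ereal_tendsto_simps)
    have "((\<lambda>x::real. - (1 / sqrt (2 * pi)) * exp (- x\<^sup>2 / 2)) \<longlongrightarrow> 0) at_top"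
      by real_asymp
    then show "(((\<lambda>x. - std_normal_density x) \<circ> real_of_ereal) \<longlongrightarrow> 0) (at_left \<infinity>)"
      by (simp add: ereal_tendsto_simps std_normal_density_def)
  qed simp
  moreover have "(LBINT x=ereal t..\<infinity>. std_normal_density x * x)
      = (\<integral>x. indicator {t<..} x * (std_normal_density x * x) \<partial>lborel)"
    by (simp add: interval_lebesgue_integral_def set_lebesgue_integral_def einterval_def
        greaterThan_def)
  moreover have "(\<integral>x. indicator {t<..} x * (std_normal_density x * x) \<partial>lborel)
      = (\<integral>x. indicator {t..} x * (std_normal_density x * x) \<partial>lborel)"
    by (intro integral_cong_AE)
      (use AE_lborel_singleton[of t] in \<open>auto split: split_indicator\<close>)
  ultimately show ?thesis by simp
qed

text \<open>The first moment over the whole line is 0, so the lower tail is minus the upper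
  one.\<close>

lemma integral_std_normal_lower_tail:
  "(\<integral>x. indicator {..t} x * (std_normal_density x * x) \<partial>lborel) = - std_normal_density t"
proof -
  have i: "integrable lborel (\<lambda>x. std_normal_density x * x)"
    using integrable_std_normal_moment[of 1] by simp
  have z: "(\<integral>x. std_normal_density x * x \<partial>lborel) = 0"
    using integral_std_normal_moment_odd[of 0] by simp
  have "(\<integral>x. indicator {..t} x * (std_normal_density x * x) \<partial>lborel)
     = (\<integral>x. std_normal_density x * x - indicator {t..} x * (std_normal_density x * x) \<partial>lborel)"
    by (intro integral_cong_AE)
      (use AE_lborel_singleton[of t] in \<open>auto split: split_indicator\<close>)
  also have "\<dots> = 0 - std_normal_density t"
    using i integrable_mult_indicator[OF _ i, of "{t..}"]
    by (subst Bochner_Integration.integral_diff)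
      (auto simp: z integral_std_normal_upper_tail)
  finally show ?thesis by simp
qed

text \<open>Let \<open>P\<close> be the normal distribution function at \<open>t\<close>.
  Integrating out \<open>y \<le> t\<close> leaves \<open>x * P + ?\<phi> t\<close>, and integrating
  this over \<open>x \<ge> t\<close> gives \<open>P * ?\<phi> t + ?\<phi> t * (1 - P)\<close>, where
  the terms with \<open>P\<close> cancel.\<close>

lemma std_normal_poincare_kernel:
  "(\<integral>\<^sup>+x. \<integral>\<^sup>+y. indicator {y..x} t * ennreal (x - y) \<partial>std_normal_measure \<partial>std_normal_measure)
    = ennreal (std_normal_density t)"
proof -
  let ?\<phi> = std_normal_density
  have i1: "integrable lborel (\<lambda>x. ?\<phi> x * x)"
    using integrable_std_normal_moment[of 1] by simp
  have i0: "integrable lborel ?\<phi>"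
    using integrable_std_normal_moment[of 0] by simp
  have one: "(\<integral>x. ?\<phi> x \<partial>lborel) = 1"
    using integral_std_normal_moment_even[of 0] by simp
  note ind = integrable_mult_indicator[OF _ i1, unfolded real_scaleR_def]
    integrable_mult_indicator[OF _ i0, unfolded real_scaleR_def]
  define P where "P = (\<integral>y. indicator {..t} y * ?\<phi> y \<partial>lborel)"
  have P0: "0 \<le> P" unfolding P_def by (intro Bochner_Integration.integral_nonneg) auto
  have Pc: "(\<integral>y. indicator {t..} y * ?\<phi> y \<partial>lborel) = 1 - P"
  proof -
    have "(\<integral>y. indicator {t..} y * ?\<phi> y \<partial>lborel)
       = (\<integral>y. ?\<phi> y - indicator {..t} y * ?\<phi> y \<partial>lborel)"
      by (intro integral_cong_AE)
        (use AE_lborel_singleton[of t] in \<open>auto split: split_indicator\<close>)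
    also have "\<dots> = 1 - P" unfolding P_def using ind i0
      by (subst Bochner_Integration.integral_diff) (auto simp: one)
    finally show ?thesis .
  qed
  have inner: "(\<integral>\<^sup>+y. indicator {y..x} t * ennreal (x - y) \<partial>std_normal_measure)
      = indicator {t..} x * ennreal (x * P + ?\<phi> t)" for x
  proof (cases "t \<le> x")
    case True
    have "(\<integral>\<^sup>+y. indicator {y..x} t * ennreal (x - y) \<partial>std_normal_measure)
        = (\<integral>\<^sup>+y. ennreal (x * (indicator {..t} y * ?\<phi> y) - indicator {..t} y * (?\<phi> y * y)) \<partial>lborel)"
    proof -
      have "(\<integral>\<^sup>+y. indicator {y..x} t * ennreal (x - y) \<partial>std_normal_measure)
          = (\<integral>\<^sup>+y. indicator {..t} y * ennreal (x - y) \<partial>std_normal_measure)"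
        using True by (auto intro!: nn_integral_cong split: split_indicator)
      also have "\<dots> = (\<integral>\<^sup>+y. ennreal (x * (indicator {..t} y * ?\<phi> y) - indicator {..t} y * (?\<phi> y * y)) \<partial>lborel)"
        by (subst nn_integral_density)
          (auto intro!: nn_integral_cong simp: ennreal_mult''[symmetric] algebra_simps
            split: split_indicator)
      finally show ?thesis .
    qed
    also have "\<dots> = ennreal (\<integral>y. x * (indicator {..t} y * ?\<phi> y) - indicator {..t} y * (?\<phi> y * y) \<partial>lborel)"
    proof (rule nn_integral_eq_integral)
      have "0 \<le> x * ?\<phi> y - ?\<phi> y * y" if "y \<le> t" for y
        using mult_right_mono[of y x "?\<phi> y"] True that by (simp add: mult.commute)
      then show "AE y in lborel. 0 \<le> x * (indicator {..t} y * ?\<phi> y) - indicator {..t} y * (?\<phi> y * y)"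
        by (auto split: split_indicator)
    qed (use ind in auto)
    also have "(\<integral>y. x * (indicator {..t} y * ?\<phi> y) - indicator {..t} y * (?\<phi> y * y) \<partial>lborel) = x * P + ?\<phi> t"
      using ind by (subst Bochner_Integration.integral_diff)
        (auto simp: integral_std_normal_lower_tail P_def)
    finally show ?thesis using True by simp
  next
    case False
    then show ?thesis by (simp add: indicator_def)
  qed
  \<comment> \<open>As \<open>x\<close> may be negative, the sign is read off from the integral of
    \<open>t - y\<close> over \<open>y \<le> t\<close>, which equals
    \<open>t * P + ?\<phi> t\<close>.\<close>
  have nn: "0 \<le> x * P + ?\<phi> t" if "t \<le> x" for x
  proof -
    have "0 \<le> (\<integral>y. indicator {..t} y * ((t - y) * ?\<phi> y) \<partial>lborel)"
      by (intro Bochner_Integration.integral_nonneg) (auto split: split_indicator)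
    also have "\<dots> = (\<integral>y. t * (indicator {..t} y * ?\<phi> y) - indicator {..t} y * (?\<phi> y * y) \<partial>lborel)"
      by (simp add: algebra_simps)
    also have "\<dots> = t * P + ?\<phi> t"
      using ind by (subst Bochner_Integration.integral_diff)
        (auto simp: integral_std_normal_lower_tail P_def)
    finally show ?thesis using mult_right_mono[OF that P0] by simp
  qed
  have "(\<integral>\<^sup>+x. indicator {t..} x * ennreal (x * P + ?\<phi> t) \<partial>std_normal_measure)
      = (\<integral>\<^sup>+x. ennreal (P * (indicator {t..} x * (?\<phi> x * x)) + ?\<phi> t * (indicator {t..} x * ?\<phi> x)) \<partial>lborel)"
    using nn by (subst nn_integral_density)
      (auto intro!: nn_integral_cong simp: ennreal_mult[symmetric] algebra_simps
          split: split_indicator)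
  also have "\<dots> = ennreal (\<integral>x. P * (indicator {t..} x * (?\<phi> x * x)) + ?\<phi> t * (indicator {t..} x * ?\<phi> x) \<partial>lborel)"
  proof (rule nn_integral_eq_integral)
    have "0 \<le> P * (?\<phi> x * x) + ?\<phi> t * ?\<phi> x" if "t \<le> x" for x
      using mult_nonneg_nonneg[OF nn[OF that], of "?\<phi> x"] by (simp add: algebra_simps)
    then show "AE x in lborel. 0 \<le> P * (indicator {t..} x * (?\<phi> x * x)) + ?\<phi> t * (indicator {t..} x * ?\<phi> x)"
      by (auto split: split_indicator)
  qed (use ind in auto)
  also have "(\<integral>x. P * (indicator {t..} x * (?\<phi> x * x)) + ?\<phi> t * (indicator {t..} x * ?\<phi> x) \<partial>lborel)
      = P * ?\<phi> t + ?\<phi> t * (1 - P)"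
    using ind by (subst Bochner_Integration.integral_add)
      (auto simp: integral_std_normal_upper_tail Pc)
  also have "\<dots> = ?\<phi> t" by (simp add: algebra_simps)
  finally show ?thesis by (simp add: inner)
qed

text \<open>Cauchy-Schwarz for \<open>f x - f y\<close> as the integral of \<open>f'\<close>. It
  follows from \<open>(f' t - m)\<^sup>2 \<ge> 0\<close> with \<open>m\<close> the mean slope: the
  minorant \<open>2 * m * f' t - m\<^sup>2\<close> of \<open>(f' t)\<^sup>2\<close> has an explicit
  antiderivative.\<close>

lemma square_increment_le:
  fixes f f' :: "real \<Rightarrow> real"
  assumes f: "\<And>t. (f has_real_derivative f' t) (at t)" and cont: "continuous_on UNIV f'"
    and "y \<le> x"
  shows "ennreal ((f x - f y)\<^sup>2) \<le> (\<integral>\<^sup>+t. indicator {y..x} t * (ennreal (x - y) * ennreal ((f' t)\<^sup>2)) \<partial>lborel)"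
proof (cases "y = x")
  case False
  with \<open>y \<le> x\<close> have yx: "y < x" by simp
  define m where "m = (f x - f y) / (x - y)"
  have c: "isCont f' t" for t
    using cont by (simp add: continuous_on_eq_continuous_at)
  have 1: "has_bochner_integral lborel (\<lambda>t. (2 * m * f' t - m\<^sup>2) * indicator {y..x} t)
      ((2 * m * f x - m\<^sup>2 * x) - (2 * m * f y - m\<^sup>2 * y))"
    by (rule has_bochner_integral_FTC_Icc_real)
      (use yx c in \<open>auto intro!: derivative_eq_intros f continuous_intros\<close>)
  have 2: "integrable lborel (\<lambda>t. (f' t)\<^sup>2 * indicator {y..x} t)"
    using borel_integrable_atLeastAtMost[of y x "\<lambda>t. (f' t)\<^sup>2"] c
    by (simp add: if_distrib indicator_def cong: if_cong)
  have "m * (f x - f y) = ((2 * m * f x - m\<^sup>2 * x) - (2 * m * f y - m\<^sup>2 * y))"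
  proof -
    have "m * (x - y) = f x - f y" using yx by (simp add: m_def)
    then have "m\<^sup>2 * (x - y) = m * (f x - f y)"
      by (simp add: power2_eq_square mult.assoc)
    then show ?thesis by (simp add: algebra_simps)
  qed
  also have "\<dots> = (\<integral>t. (2 * m * f' t - m\<^sup>2) * indicator {y..x} t \<partial>lborel)"
    using has_bochner_integral_integral_eq[OF 1] by simp
  also have "\<dots> \<le> (\<integral>t. (f' t)\<^sup>2 * indicator {y..x} t \<partial>lborel)"
  proof (rule integral_mono)
    fix t
    have "0 \<le> (f' t - m)\<^sup>2" by simp
    then show "(2 * m * f' t - m\<^sup>2) * indicator {y..x} t \<le> (f' t)\<^sup>2 * indicator {y..x} t"
      by (simp add: power2_eq_square algebra_simps split: split_indicator)
  qed (use 1 2 in \<open>auto simp: has_bochner_integral_iff\<close>)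
  finally have "(x - y) * (m * (f x - f y)) \<le> (x - y) * (\<integral>t. (f' t)\<^sup>2 * indicator {y..x} t \<partial>lborel)"
    using yx by simp
  moreover have "(x - y) * (m * (f x - f y)) = (f x - f y)\<^sup>2"
    using yx by (simp add: m_def power2_eq_square)
  ultimately have "ennreal ((f x - f y)\<^sup>2) \<le> ennreal (x - y) * ennreal (\<integral>t. (f' t)\<^sup>2 * indicator {y..x} t \<partial>lborel)"
    using yx by (subst ennreal_mult'[symmetric]) (auto intro!: ennreal_leI)
  also have "ennreal (\<integral>t. (f' t)\<^sup>2 * indicator {y..x} t \<partial>lborel)
      = (\<integral>\<^sup>+t. ennreal ((f' t)\<^sup>2 * indicator {y..x} t) \<partial>lborel)"
    by (rule nn_integral_eq_integral[symmetric]) (use 2 in auto)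
  also have "ennreal (x - y) * \<dots> = (\<integral>\<^sup>+t. ennreal (x - y) * ennreal ((f' t)\<^sup>2 * indicator {y..x} t) \<partial>lborel)"
    using borel_measurable_integrable[OF 2] by (intro nn_integral_cmult[symmetric]) auto
  also have "\<dots> = (\<integral>\<^sup>+t. indicator {y..x} t * (ennreal (x - y) * ennreal ((f' t)\<^sup>2)) \<partial>lborel)"
    by (intro nn_integral_cong) (auto split: split_indicator)
  finally show ?thesis .
qed auto

text \<open>Tonelli applied to \<open>(f x - f y)\<^sup>2 \<le> (x - y) \<integral>\<^sub>y\<^sup>x f'\<^sup>2\<close>: the resulting weight of
  \<open>f'(t)\<^sup>2\<close> is exactly the density at \<open>t\<close>, whence the sharp constant.\<close>

lemma sq_spread_std_normal_le:
  fixes f f' :: "real \<Rightarrow> real"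
  assumes f: "\<And>t. (f has_real_derivative f' t) (at t)" and cont: "continuous_on UNIV f'"
  shows "sq_spread std_normal_measure f \<le> 2 * (\<integral>\<^sup>+t. ennreal ((f' t)\<^sup>2) \<partial>std_normal_measure)"
proof -
  let ?N = std_normal_measure
  interpret N: prob_space ?N by (rule prob_space_std_normal_measure)
  interpret NN: pair_sigma_finite ?N ?N ..
  interpret NL: pair_sigma_finite ?N "lborel :: real measure" ..
  have [measurable]: "f \<in> borel_measurable borel"
    by (intro borel_measurable_continuous_onI continuous_at_imp_continuous_on)
      (use f DERIV_isCont in blast)
  have [measurable]: "f' \<in> borel_measurable borel"
    by (rule borel_measurable_continuous_onI[OF cont])
  \<comment> \<open>In this form, joint measurability in the end points and \<open>t\<close> is
    within reach of \<open>measurable\<close>.\<close>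
  have ind: "indicator {y..x} t = (if y \<le> t \<and> t \<le> x then 1 else 0 :: ennreal)" for x y t :: real
    by (simp add: indicator_def)
  \<comment> \<open>The plane is cut along the diagonal, where the integrand vanishes. By symmetry
    both halves contribute the same, which produces the factor 2.\<close>
  define h where "h x y = (if y \<le> x then ennreal ((f x - f y)\<^sup>2) else 0)" for x y
  have [measurable]: "case_prod h \<in> borel_measurable (?N \<Otimes>\<^sub>M ?N)"
    unfolding h_def by measurable
  have "sq_spread ?N f \<le> (\<integral>\<^sup>+x. \<integral>\<^sup>+y. h x y + h y x \<partial>?N \<partial>?N)"
    unfolding sq_spread_def h_def
    by (intro nn_integral_mono) (auto simp: power2_commute)
  also have "\<dots> = (\<integral>\<^sup>+x. \<integral>\<^sup>+y. h x y \<partial>?N \<partial>?N) + (\<integral>\<^sup>+x. \<integral>\<^sup>+y. h y x \<partial>?N \<partial>?N)"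
    by (simp add: nn_integral_add)
  also have "(\<integral>\<^sup>+x. \<integral>\<^sup>+y. h y x \<partial>?N \<partial>?N) = (\<integral>\<^sup>+x. \<integral>\<^sup>+y. h x y \<partial>?N \<partial>?N)"
    by (rule NN.Fubini'[symmetric]) measurable
  finally have 1: "sq_spread ?N f \<le> 2 * (\<integral>\<^sup>+x. \<integral>\<^sup>+y. h x y \<partial>?N \<partial>?N)"
    by (simp add: mult_2)
  have "(\<integral>\<^sup>+x. \<integral>\<^sup>+y. h x y \<partial>?N \<partial>?N)
      \<le> (\<integral>\<^sup>+x. \<integral>\<^sup>+y. \<integral>\<^sup>+t. indicator {y..x} t * (ennreal (x - y) * ennreal ((f' t)\<^sup>2)) \<partial>lborel \<partial>?N \<partial>?N)"
    unfolding h_def by (intro nn_integral_mono) (auto intro!: square_increment_le f cont)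
  also have "\<dots> = (\<integral>\<^sup>+x. \<integral>\<^sup>+t. \<integral>\<^sup>+y. indicator {y..x} t * (ennreal (x - y) * ennreal ((f' t)\<^sup>2)) \<partial>?N \<partial>lborel \<partial>?N)"
    unfolding ind by (intro nn_integral_cong NL.Fubini'[symmetric]) measurable
  also have "\<dots> = (\<integral>\<^sup>+t. \<integral>\<^sup>+x. \<integral>\<^sup>+y. indicator {y..x} t * (ennreal (x - y) * ennreal ((f' t)\<^sup>2)) \<partial>?N \<partial>?N \<partial>lborel)"
    unfolding ind by (intro NL.Fubini'[symmetric]) measurable
  also have "\<dots> = (\<integral>\<^sup>+t. (\<integral>\<^sup>+x. \<integral>\<^sup>+y. indicator {y..x} t * ennreal (x - y) \<partial>?N \<partial>?N) * ennreal ((f' t)\<^sup>2) \<partial>lborel)"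
    unfolding ind by (simp add: nn_integral_multc mult.assoc[symmetric])
  also have "\<dots> = (\<integral>\<^sup>+t. ennreal ((f' t)\<^sup>2) \<partial>?N)"
    by (simp add: std_normal_poincare_kernel nn_integral_density)
  finally show ?thesis using 1 by (meson mult_left_mono order_trans zero_le)
qed

text \<open>Tensorization of the variance (Efron-Stein for two factors). For the quadrilateral of
  values at \<open>(x, y)\<close>, \<open>(x', y)\<close>, \<open>(x', y')\<close>,
  \<open>(x, y')\<close>, the squares of the two diagonals sum to at most those of the four sides.
  Each diagonal integrates to the left-hand side, by exchanging \<open>y\<close> and
  \<open>y'\<close>; opposite sides have equal integrals.\<close>

lemma sq_spread_pair_le:
  assumes "prob_space M1" "prob_space M2"
    and [measurable]: "f \<in> borel_measurable (M1 \<Otimes>\<^sub>M M2)"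
  shows "sq_spread (M1 \<Otimes>\<^sub>M M2) f
    \<le> (\<integral>\<^sup>+y. sq_spread M1 (\<lambda>x. f (x, y)) \<partial>M2) + (\<integral>\<^sup>+x. sq_spread M2 (\<lambda>y. f (x, y)) \<partial>M1)"
proof -
  interpret M1: prob_space M1 by fact
  interpret M2: prob_space M2 by fact
  interpret P: pair_sigma_finite M1 M2 ..
  interpret P2: pair_sigma_finite M2 M2 ..
  let ?q = "\<lambda>u v. ennreal ((u - v)\<^sup>2)"
  let ?S = "sq_spread (M1 \<Otimes>\<^sub>M M2) f"
  let ?V1 = "\<integral>\<^sup>+y. sq_spread M1 (\<lambda>x. f (x, y)) \<partial>M2"
  let ?V2 = "\<integral>\<^sup>+x. sq_spread M2 (\<lambda>y. f (x, y)) \<partial>M1"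
  have "?S = (\<integral>\<^sup>+x. \<integral>\<^sup>+y. \<integral>\<^sup>+x'. \<integral>\<^sup>+y'. ?q (f (x, y)) (f (x', y')) \<partial>M2 \<partial>M1 \<partial>M2 \<partial>M1)"
    unfolding sq_spread_def by (simp add: M2.nn_integral_fst[symmetric])
  also have "\<dots> = (\<integral>\<^sup>+x. \<integral>\<^sup>+x'. \<integral>\<^sup>+y. \<integral>\<^sup>+y'. ?q (f (x, y)) (f (x', y')) \<partial>M2 \<partial>M2 \<partial>M1 \<partial>M1)"
    by (intro nn_integral_cong P.Fubini') measurable
  finally have S1: "?S = \<dots>" .
  also have "\<dots> = (\<integral>\<^sup>+x. \<integral>\<^sup>+x'. \<integral>\<^sup>+y. \<integral>\<^sup>+y'. ?q (f (x, y')) (f (x', y)) \<partial>M2 \<partial>M2 \<partial>M1 \<partial>M1)"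
    by (intro nn_integral_cong P2.Fubini') measurable
  finally have S2: "?S = \<dots>" .
  have "2 * ?S = (\<integral>\<^sup>+x. \<integral>\<^sup>+x'. \<integral>\<^sup>+y. \<integral>\<^sup>+y'.
      ?q (f (x, y)) (f (x', y')) + ?q (f (x, y')) (f (x', y)) \<partial>M2 \<partial>M2 \<partial>M1 \<partial>M1)"
    unfolding mult_2 by (subst S1, subst S2) (simp add: nn_integral_add cong: nn_integral_cong_simp)
  also have "\<dots> \<le> (\<integral>\<^sup>+x. \<integral>\<^sup>+x'. \<integral>\<^sup>+y. \<integral>\<^sup>+y'.
      (?q (f (x, y)) (f (x', y)) + ?q (f (x, y')) (f (x', y')))
      + (?q (f (x, y)) (f (x, y')) + ?q (f (x', y)) (f (x', y'))) \<partial>M2 \<partial>M2 \<partial>M1 \<partial>M1)"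
  proof (intro nn_integral_mono)
    fix x x' y y'
    let ?a = "f (x, y)" and ?b = "f (x', y)" and ?c = "f (x, y')" and ?d = "f (x', y')"
    have "0 \<le> (?a - ?b - ?c + ?d)\<^sup>2" by simp
    then have "(?a - ?d)\<^sup>2 + (?c - ?b)\<^sup>2 \<le> (?a - ?b)\<^sup>2 + (?c - ?d)\<^sup>2 + ((?a - ?c)\<^sup>2 + (?b - ?d)\<^sup>2)"
      by (simp add: power2_eq_square algebra_simps)
    then show "?q ?a ?d + ?q ?c ?b \<le> ?q ?a ?b + ?q ?c ?d + (?q ?a ?c + ?q ?b ?d)"
      by (simp add: ennreal_plus[symmetric] del: ennreal_plus)
  qed
  also have "\<dots> = ((\<integral>\<^sup>+x. \<integral>\<^sup>+x'. \<integral>\<^sup>+y. ?q (f (x, y)) (f (x', y)) \<partial>M2 \<partial>M1 \<partial>M1)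
        + (\<integral>\<^sup>+x. \<integral>\<^sup>+x'. \<integral>\<^sup>+y. ?q (f (x, y)) (f (x', y)) \<partial>M2 \<partial>M1 \<partial>M1)) + (?V2 + ?V2)"
    unfolding sq_spread_def by (simp add: nn_integral_add M1.emeasure_space_1 M2.emeasure_space_1 cong: nn_integral_cong_simp)
  also have "(\<integral>\<^sup>+x. \<integral>\<^sup>+x'. \<integral>\<^sup>+y. ?q (f (x, y)) (f (x', y)) \<partial>M2 \<partial>M1 \<partial>M1)
      = (\<integral>\<^sup>+x. \<integral>\<^sup>+y. \<integral>\<^sup>+x'. ?q (f (x, y)) (f (x', y)) \<partial>M1 \<partial>M2 \<partial>M1)"
    by (intro nn_integral_cong P.Fubini'[symmetric]) measurable
  also have "\<dots> = ?V1"
    unfolding sq_spread_def by (intro P.Fubini'[symmetric]) measurable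
  finally have "2 * ?S \<le> 2 * (?V1 + ?V2)"
    by (simp add: mult_2 ac_simps)
  then show ?thesis
    using ennreal_mult_le_mult_iff[of 2 ?S "?V1 + ?V2"] by simp
qed

lemma sq_spread_distr:
  assumes "sigma_finite_measure M"
    and [measurable]: "T \<in> measurable M N" "f \<in> borel_measurable N"
  shows "sq_spread (distr M N T) f = sq_spread M (\<lambda>x. f (T x))"
proof -
  interpret sigma_finite_measure M by fact
  show ?thesis
    unfolding sq_spread_def by (simp add: nn_integral_distr)
qed

text \<open>Induction on \<open>I\<close>: tensorization splits off one coordinate, to which the
  inequality on the line applies with the others frozen. Derivative and continuity are required only
  along single coordinates, in the form \<open>x(i := t)\<close>, because these hypotheses survive
  the freezing of a coordinate.\<close>

lemma sq_spread_PiM_std_normal_le: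
  fixes f :: "('i \<Rightarrow> real) \<Rightarrow> real" and f' :: "'i \<Rightarrow> ('i \<Rightarrow> real) \<Rightarrow> real"
  assumes "finite I"
    and "f \<in> borel_measurable (PiM I (\<lambda>_. std_normal_measure))"
    and "\<And>i. i \<in> I \<Longrightarrow> f' i \<in> borel_measurable (PiM I (\<lambda>_. std_normal_measure))"
    and "\<And>i x t. i \<in> I \<Longrightarrow> ((\<lambda>t. f (x(i := t))) has_real_derivative f' i (x(i := t))) (at t)"
    and "\<And>i x. i \<in> I \<Longrightarrow> continuous_on UNIV (\<lambda>t. f' i (x(i := t)))"
  shows "sq_spread (PiM I (\<lambda>_. std_normal_measure)) f
    \<le> 2 * (\<integral>\<^sup>+x. (\<Sum>i\<in>I. ennreal ((f' i x)\<^sup>2)) \<partial>PiM I (\<lambda>_. std_normal_measure))"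
  using assms
proof (induction I arbitrary: f f' rule: finite_induct)
  case empty
  have "sq_spread (PiM {} (\<lambda>_. std_normal_measure)) f = 0"
    unfolding sq_spread_def by (simp add: space_PiM cong: nn_integral_cong_simp)
  then show ?case by simp
next
  case (insert i I)
  let ?N = std_normal_measure
  let ?P = "PiM I (\<lambda>_. ?N)" and ?Q = "PiM (insert i I) (\<lambda>_. ?N)"
  interpret N: prob_space ?N by (rule prob_space_std_normal_measure)
  interpret product_prob_space "\<lambda>_::'i. ?N" ..
  interpret PI: prob_space ?P by (rule prob_space_PiM) (rule prob_space_std_normal_measure)
  interpret NP: pair_sigma_finite ?N ?P ..
  note [measurable] = insert.prems(1)
  have f'm [measurable]: "f' j \<in> borel_measurable ?Q" if "j \<in> insert i I" for j
    using insert.prems(2) that .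
  have T [measurable]: "(\<lambda>(y, X). X(i := y)) \<in> measurable (?N \<Otimes>\<^sub>M ?P) ?Q"
    unfolding split_beta by (rule measurable_fun_upd[where J=I]) auto
  have upd [measurable]: "(\<lambda>X. X(i := y)) \<in> measurable ?P ?Q" for y
    by (rule measurable_fun_upd[where J=I]) auto
  have Q: "distr (?N \<Otimes>\<^sub>M ?P) ?Q (\<lambda>(y, X). X(i := y)) = ?Q"
    using insert.hyps by (intro distr_pair_PiM_eq_PiM) (auto intro: prob_space_std_normal_measure)
  have "sq_spread ?Q f = sq_spread (?N \<Otimes>\<^sub>M ?P) (\<lambda>z. f (case z of (y, X) \<Rightarrow> X(i := y)))"
    by (subst Q[symmetric], rule sq_spread_distr[OF NP.sigma_finite_measure_axioms T insert.prems(1)])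
  also have "\<dots> \<le> (\<integral>\<^sup>+X. sq_spread ?N (\<lambda>y. f (X(i := y))) \<partial>?P) + (\<integral>\<^sup>+y. sq_spread ?P (\<lambda>X. f (X(i := y))) \<partial>?N)"
    by (rule order_trans[OF sq_spread_pair_le])
      (auto intro: prob_space_std_normal_measure PI.prob_space_axioms)
  also have "\<dots> \<le> (\<integral>\<^sup>+X. 2 * (\<integral>\<^sup>+y. ennreal ((f' i (X(i := y)))\<^sup>2) \<partial>?N) \<partial>?P)
      + (\<integral>\<^sup>+y. 2 * (\<integral>\<^sup>+X. (\<Sum>j\<in>I. ennreal ((f' j (X(i := y)))\<^sup>2)) \<partial>?P) \<partial>?N)"
  proof (intro add_mono nn_integral_mono)
    show "sq_spread ?N (\<lambda>y. f (X(i := y))) \<le> 2 * (\<integral>\<^sup>+y. ennreal ((f' i (X(i := y)))\<^sup>2) \<partial>?N)" for X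
      by (rule sq_spread_std_normal_le; rule insert.prems(3,4)) simp_all
    show "sq_spread ?P (\<lambda>X. f (X(i := y))) \<le> 2 * (\<integral>\<^sup>+X. (\<Sum>j\<in>I. ennreal ((f' j (X(i := y)))\<^sup>2)) \<partial>?P)" for y
    proof (rule insert.IH[of _ "\<lambda>j X. f' j (X(i := y))"])
      fix j X t assume j: "j \<in> I"
      have twist: "(X(j := t))(i := y) = (X(i := y))(j := t)" for t
        using j insert.hyps by (intro fun_upd_twist) auto
      show "((\<lambda>t. f ((X(j := t))(i := y))) has_real_derivative f' j ((X(j := t))(i := y))) (at t)"
        using insert.prems(3)[of j "X(i := y)" t] j unfolding twist by blast
      show "continuous_on UNIV (\<lambda>t. f' j ((X(j := t))(i := y)))"
        using insert.prems(4)[of j "X(i := y)"] j unfolding twist by blast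
    next
      fix j assume "j \<in> I"
      then show "(\<lambda>X. f' j (X(i := y))) \<in> borel_measurable ?P"
        by (intro measurable_compose[OF upd f'm]) auto
    qed measurable
  qed
  also have "\<dots> = 2 * (\<integral>\<^sup>+x. ennreal ((f' i x)\<^sup>2) \<partial>?Q) + 2 * (\<integral>\<^sup>+x. (\<Sum>j\<in>I. ennreal ((f' j x)\<^sup>2)) \<partial>?Q)"
  proof -
    have *: "(\<integral>\<^sup>+x. g x \<partial>?Q) = (\<integral>\<^sup>+X. \<integral>\<^sup>+y. g (X(i := y)) \<partial>?N \<partial>?P)"
      "(\<integral>\<^sup>+x. g x \<partial>?Q) = (\<integral>\<^sup>+y. \<integral>\<^sup>+X. g (X(i := y)) \<partial>?P \<partial>?N)"
      if [measurable]: "g \<in> borel_measurable ?Q" for g :: "_ \<Rightarrow> ennreal"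
      using insert.hyps that
      by (auto intro: product_nn_integral_insert product_nn_integral_insert_rev)
    have m1: "(\<lambda>x. ennreal ((f' i x)\<^sup>2)) \<in> borel_measurable ?Q"
      and m2: "(\<lambda>x. \<Sum>j\<in>I. ennreal ((f' j x)\<^sup>2)) \<in> borel_measurable ?Q"
      by measurable
    have n1: "(\<integral>\<^sup>+X. 2 * (\<integral>\<^sup>+y. g (X(i := y)) \<partial>?N) \<partial>?P) = 2 * (\<integral>\<^sup>+x. g x \<partial>?Q)"
      if [measurable]: "g \<in> borel_measurable ?Q" for g :: "_ \<Rightarrow> ennreal"
      unfolding *(1)[OF that] by (rule nn_integral_cmult) measurable
    have n2: "(\<integral>\<^sup>+y. 2 * (\<integral>\<^sup>+X. g (X(i := y)) \<partial>?P) \<partial>?N) = 2 * (\<integral>\<^sup>+x. g x \<partial>?Q)"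
      if [measurable]: "g \<in> borel_measurable ?Q" for g :: "_ \<Rightarrow> ennreal"
      unfolding *(2)[OF that] by (rule nn_integral_cmult) measurable
    show ?thesis using n1[OF m1] n2[OF m2] by simp
  qed
  also have "\<dots> = 2 * (\<integral>\<^sup>+x. (\<Sum>j\<in>insert i I. ennreal ((f' j x)\<^sup>2)) \<partial>?Q)"
    using insert.hyps by (simp add: nn_integral_add distrib_left del: sum_ennreal)
  finally show ?case .
qed

section \<open>Standard Gaussian measure on a Euclidean space\<close>

lemma nn_integral_lborel_translate:
  fixes f :: "'a::euclidean_space \<Rightarrow> ennreal"
  assumes [measurable]: "f \<in> borel_measurable borel"
  shows "(\<integral>\<^sup>+x. f (c + x) \<partial>lborel) = (\<integral>\<^sup>+x. f x \<partial>lborel)"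
proof -
  have "(\<integral>\<^sup>+x. f x \<partial>distr lborel borel ((+) c)) = (\<integral>\<^sup>+x. f (c + x) \<partial>lborel)"
    by (subst nn_integral_distr) auto
  then show ?thesis by (simp add: lborel_distr_plus)
qed

lemma borel_measurable_orthogonal_transformation:
  fixes T :: "'a::euclidean_space \<Rightarrow> 'a"
  assumes "orthogonal_transformation T"
  shows "T \<in> borel_measurable borel"
  using assms
  by (intro borel_measurable_continuous_onI linear_continuous_on)
    (auto simp: orthogonal_transformation_def linear_conv_bounded_linear)

text \<open>Uniqueness of translation-invariant measures up to a factor; the unit ball, which \<open>T\<close>
  preserves, shows that the factor is 1.\<close>

lemma nn_integral_lborel_orthogonal_transformation:
  fixes T :: "'a::euclidean_space \<Rightarrow> 'a" and f :: "'a \<Rightarrow> ennreal"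
  assumes T: "orthogonal_transformation T" and [measurable]: "f \<in> borel_measurable borel"
  shows "(\<integral>\<^sup>+x. f (T x) \<partial>lborel) = (\<integral>\<^sup>+x. f x \<partial>lborel)"
proof -
  note [measurable] = borel_measurable_orthogonal_transformation[OF T]
  let ?g = "indicator (ball (0::'a) 1) :: 'a \<Rightarrow> ennreal"
  have [measurable]: "?g \<in> borel_measurable borel"
    by (intro borel_measurable_indicator borel_open) simp
  let ?C = "\<integral>\<^sup>+y. ?g y \<partial>lborel"
  have "linear T" using T by (simp add: orthogonal_transformation_def)
  \<comment> \<open>The volume of the ball must be neither 0 nor infinite, since it is cancelled at
    the end.\<close>
  have "?C = emeasure lborel (ball (0::'a) 1)" by simp
  moreover have "emeasure lborel (ball (0::'a) 1) \<noteq> 0"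
    using open_not_negligible[of "ball (0::'a) 1"]
    by (simp add: negligible_iff_emeasure0 emeasure_lborel_ball_finite)
  moreover have "emeasure lborel (ball (0::'a) 1) \<noteq> \<infinity>"
    using emeasure_lborel_ball_finite[of "0::'a" 1] by simp
  ultimately have C: "?C \<noteq> 0" "?C \<noteq> \<infinity>" by auto
  have "?C * (\<integral>\<^sup>+x. f (T x) \<partial>lborel) = (\<integral>\<^sup>+x. f (T x) * (\<integral>\<^sup>+y. ?g y \<partial>lborel) \<partial>lborel)"
    by (subst nn_integral_multc) (auto simp: mult.commute)
  also have "\<dots> = (\<integral>\<^sup>+x. f (T x) * (\<integral>\<^sup>+y. ?g (- T x + y) \<partial>lborel) \<partial>lborel)"
    by (subst nn_integral_lborel_translate) auto
  also have "\<dots> = (\<integral>\<^sup>+x. \<integral>\<^sup>+y. f (T x) * ?g (- T x + y) \<partial>lborel \<partial>lborel)"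
    by (intro nn_integral_cong nn_integral_cmult[symmetric]) measurable
  also have "\<dots> = (\<integral>\<^sup>+y. \<integral>\<^sup>+x. f (T x) * ?g (- T x + y) \<partial>lborel \<partial>lborel)"
    by (rule lborel_pair.Fubini'[symmetric]) measurable
  also have "\<dots> = (\<integral>\<^sup>+y. \<integral>\<^sup>+x. f (y + T x) * ?g x \<partial>lborel \<partial>lborel)"
  proof (rule nn_integral_cong)
    fix y
    \<comment> \<open>Translating \<open>x\<close> by \<open>z\<close> turns \<open>T x\<close> into
      \<open>y + T x\<close>, and the ball condition on \<open>- T x + y\<close> into one on
      \<open>- T x\<close>, that is on \<open>x\<close>, since \<open>T\<close> preserves
      norms.\<close>
    obtain z where z: "y = T z"
      using orthogonal_transformation_surj[OF T] by (metis surjD)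
    have "(\<integral>\<^sup>+x. f (T x) * ?g (- T x + y) \<partial>lborel) = (\<integral>\<^sup>+x. f (T (z + x)) * ?g (- T (z + x) + y) \<partial>lborel)"
      by (rule nn_integral_lborel_translate[symmetric]) measurable
    also have "\<dots> = (\<integral>\<^sup>+x. f (y + T x) * ?g x \<partial>lborel)"
      by (intro nn_integral_cong)
        (simp add: z linear_add[OF \<open>linear T\<close>] indicator_def orthogonal_transformation_norm[OF T])
    finally show "(\<integral>\<^sup>+x. f (T x) * ?g (- T x + y) \<partial>lborel) = (\<integral>\<^sup>+x. f (y + T x) * ?g x \<partial>lborel)" .
  qed
  also have "\<dots> = (\<integral>\<^sup>+x. \<integral>\<^sup>+y. f (y + T x) * ?g x \<partial>lborel \<partial>lborel)"
    by (rule lborel_pair.Fubini'[symmetric]) measurable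
  also have "\<dots> = (\<integral>\<^sup>+x. (\<integral>\<^sup>+y. f (T x + y) \<partial>lborel) * ?g x \<partial>lborel)"
    by (intro nn_integral_cong) (simp add: nn_integral_multc add.commute)
  also have "\<dots> = (\<integral>\<^sup>+y. f y \<partial>lborel) * ?C"
    by (simp add: nn_integral_lborel_translate nn_integral_cmult)
  finally have eq: "?C * (\<integral>\<^sup>+x. f (T x) \<partial>lborel) = ?C * (\<integral>\<^sup>+y. f y \<partial>lborel)"
    by (simp add: mult.commute)
  show ?thesis
    using C eq ennreal_mult_cancel_left[of ?C] by auto
qed

definition std_gaussian :: "'a::euclidean_space measure" where
  "std_gaussian = density lborel (\<lambda>x. \<Prod>b\<in>Basis. ennreal (std_normal_density (x \<bullet> b)))"

lemma sets_std_gaussian [simp, measurable_cong]: "sets std_gaussian = sets borel"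
  by (simp add: std_gaussian_def)

lemma space_std_gaussian [simp]: "space std_gaussian = UNIV"
  by (simp add: std_gaussian_def)

text \<open>In this form the density is a function of the norm alone, which is what rotation
  invariance and the product formula rest on.\<close>

lemma prod_std_normal_density:
  fixes x :: "'a::euclidean_space"
  shows "(\<Prod>b\<in>Basis. ennreal (std_normal_density (x \<bullet> b)))
    = ennreal ((1 / sqrt (2 * pi)) ^ DIM('a) * exp (- (norm x)\<^sup>2 / 2))"
proof -
  have "(norm x)\<^sup>2 = (\<Sum>b\<in>Basis. (x \<bullet> b)\<^sup>2)"
    by (subst power2_norm_eq_inner, subst euclidean_inner) (simp add: power2_eq_square)
  then show ?thesis
    by (simp add: prod_ennreal std_normal_density_def prod.distrib exp_sum[symmetric]
        sum_negf sum_divide_distrib power_one_over prod_dividef)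
qed

text \<open>The bridge to the product measure on which the Poincare inequality was proved by
  induction. Lebesgue measure is itself the image of a product measure under the same coordinate
  map, so that only densities need to be compared; for the product measures this is checked on
  boxes.\<close>

lemma std_gaussian_eq_distr_PiM:
  "(std_gaussian :: 'a::euclidean_space measure)
    = distr (PiM Basis (\<lambda>_. std_normal_measure)) borel (\<lambda>v. \<Sum>b\<in>Basis. v b *\<^sub>R b)"
proof -
  let ?L = "PiM (Basis :: 'a set) (\<lambda>_. lborel :: real measure)"
  let ?d = "\<lambda>v. \<Prod>b\<in>(Basis :: 'a set). ennreal (std_normal_density (v b))"
  interpret L: product_sigma_finite "\<lambda>_::'a. lborel :: real measure" ..
  interpret N: prob_space std_normal_measure by (rule prob_space_std_normal_measure)
  interpret N: product_sigma_finite "\<lambda>_::'a. std_normal_measure" ..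
  have "density ?L ?d = PiM Basis (\<lambda>_. std_normal_measure)"
  proof (rule N.PiM_eqI)
    show "sets (density ?L ?d) = sets (PiM Basis (\<lambda>_. std_normal_measure))"
      by (simp cong: sets_PiM_cong)
    fix A :: "'a \<Rightarrow> real set" assume A: "\<And>b. b \<in> Basis \<Longrightarrow> A b \<in> sets std_normal_measure"
    then have A' [measurable]: "A b \<in> sets borel" if "b \<in> Basis" for b using that by simp
    have [measurable]: "PiE Basis A \<in> sets ?L"
      using A by (intro sets_PiM_I_finite) auto
    have "emeasure (density ?L ?d) (PiE Basis A) = (\<integral>\<^sup>+v. ?d v * indicator (PiE Basis A) v \<partial>?L)"
      by (subst emeasure_density) (auto intro!: borel_measurable_prod_ennreal)
    also have "\<dots> = (\<integral>\<^sup>+v. (\<Prod>b\<in>Basis. ennreal (std_normal_density (v b)) * indicator (A b) (v b)) \<partial>?L)"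
    proof (rule nn_integral_cong)
      fix v :: "'a \<Rightarrow> real" assume v: "v \<in> space ?L"
      show "?d v * indicator (PiE Basis A) v = (\<Prod>b\<in>Basis. ennreal (std_normal_density (v b)) * indicator (A b) (v b))"
      proof (cases "v \<in> PiE Basis A")
        case True
        then show ?thesis by (auto intro!: prod.cong simp: PiE_iff)
      next
        case False
        then obtain b where "b \<in> Basis" "v b \<notin> A b" using v by (auto simp: space_PiM PiE_iff)
        then have "(\<Prod>b\<in>Basis. ennreal (std_normal_density (v b)) * indicator (A b) (v b)) = 0"
          by (intro prod_zero bexI[of _ b]) auto
        then show ?thesis using False by simp
      qed
    qed
    also have "\<dots> = (\<Prod>b\<in>Basis. \<integral>\<^sup>+t. ennreal (std_normal_density t) * indicator (A b) t \<partial>lborel)"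
      by (rule L.product_nn_integral_prod) auto
    also have "\<dots> = (\<Prod>b\<in>Basis. emeasure std_normal_measure (A b))"
      by (intro prod.cong refl) (simp add: emeasure_density A')
    finally show "emeasure (density ?L ?d) (PiE Basis A) = (\<Prod>b\<in>Basis. emeasure std_normal_measure (A b))" .
  qed simp
  then have "distr (PiM Basis (\<lambda>_. std_normal_measure)) borel (\<lambda>v. \<Sum>b\<in>(Basis::'a set). v b *\<^sub>R b)
      = distr (density ?L ?d) borel (\<lambda>v. \<Sum>b\<in>Basis. v b *\<^sub>R b)"
    by simp
  also have "\<dots> = distr (density ?L (\<lambda>v. \<Prod>c\<in>Basis. ennreal (std_normal_density ((\<Sum>b\<in>Basis. v b *\<^sub>R b) \<bullet> c)))) borel (\<lambda>v. \<Sum>b\<in>Basis. v b *\<^sub>R b)"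
    by (intro arg_cong[where f="\<lambda>m. distr m borel _"] density_cong)
      (auto intro!: borel_measurable_prod_ennreal AE_I2 prod.cong simp: inner_sum_left_Basis cong: prod.cong)
  also have "\<dots> = density (distr ?L borel (\<lambda>v. \<Sum>b\<in>Basis. v b *\<^sub>R b)) (\<lambda>x. \<Prod>b\<in>Basis. ennreal (std_normal_density (x \<bullet> b)))"
    by (rule density_distr[symmetric]) measurable
  also have "\<dots> = std_gaussian"
    unfolding std_gaussian_def by (subst (2) lborel_eq) (rule refl)
  finally show ?thesis by simp
qed

lemma prob_space_std_gaussian: "prob_space (std_gaussian :: 'a::euclidean_space measure)"
  unfolding std_gaussian_eq_distr_PiM
  by (rule prob_space.prob_space_distr[OF prob_space_PiM])
    (auto intro: prob_space_std_normal_measure)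

text \<open>\<open>T\<close> preserves both Lebesgue measure and the density.\<close>

lemma distr_std_gaussian_orthogonal_transformation:
  fixes T :: "'a::euclidean_space \<Rightarrow> 'a"
  assumes T: "orthogonal_transformation T"
  shows "distr std_gaussian borel T = std_gaussian"
proof (rule measure_eqI)
  note [measurable] = borel_measurable_orthogonal_transformation[OF T]
  let ?d = "\<lambda>x::'a. ennreal ((1 / sqrt (2 * pi)) ^ DIM('a) * exp (- (norm x)\<^sup>2 / 2))"
  have [measurable]: "?d \<in> borel_measurable borel" by measurable
  fix A assume "A \<in> sets (distr std_gaussian borel T)"
  then have [measurable]: "A \<in> sets borel" by simp
  have [measurable]: "T -` A \<in> sets borel"
    using measurable_sets[OF borel_measurable_orthogonal_transformation[OF T], of A] by simp
  have "emeasure (distr std_gaussian borel T) A = emeasure std_gaussian (T -` A)"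
    by (subst emeasure_distr) auto
  also have "\<dots> = (\<integral>\<^sup>+x. ?d (T x) * indicator A (T x) \<partial>lborel)"
    unfolding std_gaussian_def prod_std_normal_density
    by (subst emeasure_density)
      (auto intro!: nn_integral_cong simp: orthogonal_transformation_norm[OF T] split: split_indicator)
  also have "\<dots> = (\<integral>\<^sup>+x. ?d x * indicator A x \<partial>lborel)"
    by (rule nn_integral_lborel_orthogonal_transformation[OF T]) measurable
  also have "\<dots> = emeasure std_gaussian A"
    unfolding std_gaussian_def prod_std_normal_density by (subst emeasure_density) auto
  finally show "emeasure (distr std_gaussian borel T) A = emeasure std_gaussian A" .
qed simp

text \<open>Squared norms add up in a pair, so the exponentials multiply. Two independent Gaussian
  matrices thus form a single Gaussian vector, to which rotations mixing them can be
  applied.\<close>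

lemma std_gaussian_pair:
  "(std_gaussian :: 'a::euclidean_space measure) \<Otimes>\<^sub>M (std_gaussian :: 'b::euclidean_space measure) = std_gaussian"
proof -
  have s: "sigma_finite_measure (std_gaussian :: 'b measure)"
    by (intro finite_measure.sigma_finite_measure prob_space.finite_measure prob_space_std_gaussian)
  have "(std_gaussian :: 'a measure) \<Otimes>\<^sub>M (std_gaussian :: 'b measure)
      = density (lborel \<Otimes>\<^sub>M lborel) (\<lambda>(x::'a, y::'b).
        ennreal ((1 / sqrt (2 * pi)) ^ DIM('a) * exp (- (norm x)\<^sup>2 / 2))
        * ennreal ((1 / sqrt (2 * pi)) ^ DIM('b) * exp (- (norm y)\<^sup>2 / 2)))"
    using s unfolding std_gaussian_def prod_std_normal_density
    by (intro pair_measure_density) (auto intro: sigma_finite_lborel)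
  also have "\<dots> = (std_gaussian :: ('a \<times> 'b) measure)"
    unfolding std_gaussian_def prod_std_normal_density lborel_prod
    by (intro arg_cong[where f="density lborel"] ext)
      (auto simp: ennreal_mult'[symmetric] power_add norm_Pair exp_add[symmetric] field_simps)
  finally show ?thesis .
qed

text \<open>With the doubling in \<open>sq_spread\<close>, this says that a smooth
  \<open>K\<close>-Lipschitz function has variance at most \<open>K\<^sup>2\<close>, whatever the
  dimension.\<close>

lemma sq_spread_std_gaussian_le:
  fixes f :: "'a::euclidean_space \<Rightarrow> real"
  assumes f: "\<And>x. (f has_derivative f' x) (at x)"
    and cont: "\<And>b. b \<in> Basis \<Longrightarrow> continuous_on UNIV (\<lambda>x. f' x b)"
    and bound: "\<And>x h. \<bar>f' x h\<bar> \<le> K * norm h"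
  shows "sq_spread std_gaussian f \<le> ennreal (2 * K\<^sup>2)"
proof -
  let ?N = std_normal_measure
  let ?P = "PiM (Basis :: 'a set) (\<lambda>_. ?N)"
  let ?T = "\<lambda>v. \<Sum>b\<in>(Basis :: 'a set). v b *\<^sub>R b"
  interpret P: prob_space ?P by (rule prob_space_PiM) (rule prob_space_std_normal_measure)
  have fm [measurable]: "f \<in> borel_measurable borel"
    by (intro borel_measurable_continuous_onI continuous_at_imp_continuous_on)
      (use f has_derivative_continuous in blast)
  have f'm: "(\<lambda>x. f' x b) \<in> borel_measurable borel" if "b \<in> Basis" for b
    using cont[OF that] by (rule borel_measurable_continuous_onI)
  have T [measurable]: "?T \<in> measurable ?P borel" by measurable
  have Tupd: "?T (v(b := t)) = ?T v + (t - v b) *\<^sub>R b" if "b \<in> Basis" for v b t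
  proof -
    have "?T (v(b := t)) = t *\<^sub>R b + (\<Sum>c\<in>Basis - {b}. v c *\<^sub>R c)"
      using that by (subst sum.remove[of _ b]) (auto intro!: sum.cong)
    moreover have "?T v = v b *\<^sub>R b + (\<Sum>c\<in>Basis - {b}. v c *\<^sub>R c)"
      using that by (subst sum.remove[of _ b]) auto
    ultimately show ?thesis by (simp add: algebra_simps)
  qed
  have lin: "linear (f' x)" for x using has_derivative_linear[OF f] .
  \<comment> \<open>The bound on the differential is tested on the gradient \<open>h\<close> itself;
    bounding the partial derivatives one by one would cost a factor of the dimension.\<close>
  have grad: "(\<Sum>b\<in>Basis. (f' x b)\<^sup>2) \<le> K\<^sup>2" for x
  proof -
    define h where "h = (\<Sum>b\<in>Basis. f' x b *\<^sub>R b)"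
    have n: "(norm h)\<^sup>2 = (\<Sum>b\<in>Basis. (f' x b)\<^sup>2)"
      unfolding power2_norm_eq_inner
      by (subst euclidean_inner) (auto intro!: sum.cong simp: h_def power2_eq_square)
    have "f' x h = (\<Sum>b\<in>Basis. (f' x b)\<^sup>2)"
      by (simp add: h_def linear_sum[OF lin] linear_cmul[OF lin] power2_eq_square)
    then have "norm h * norm h \<le> K * norm h"
      using bound[of x h] n by (simp add: power2_eq_square)
    then have "norm h = 0 \<or> norm h \<le> K" by (auto simp: mult_le_cancel_right)
    then show ?thesis unfolding n[symmetric]
      by (elim disjE) (simp, intro power_mono, simp_all)
  qed
  have "sq_spread std_gaussian f = sq_spread ?P (\<lambda>v. f (?T v))"
    unfolding std_gaussian_eq_distr_PiM
    by (rule sq_spread_distr[OF P.sigma_finite_measure_axioms T fm])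
  also have "\<dots> \<le> 2 * (\<integral>\<^sup>+v. (\<Sum>b\<in>Basis. ennreal ((f' (?T v) b)\<^sup>2)) \<partial>?P)"
  proof (rule sq_spread_PiM_std_normal_le)
    fix b v t assume b: "b \<in> (Basis :: 'a set)"
    have "((\<lambda>t. ?T v + (t - v b) *\<^sub>R b) has_derivative (\<lambda>d. d *\<^sub>R b)) (at t)"
      by (auto intro!: derivative_eq_intros)
    from has_derivative_compose[OF this f]
    have "((\<lambda>t. f (?T (v(b := t)))) has_derivative (\<lambda>d. f' (?T (v(b := t))) (d *\<^sub>R b))) (at t)"
      by (simp only: Tupd[OF b])
    then show "((\<lambda>t. f (?T (v(b := t)))) has_real_derivative f' (?T (v(b := t))) b) (at t)"
      by (rule has_derivative_imp_has_field_derivative) (simp add: linear_cmul[OF lin])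
  next
    fix b v assume b: "b \<in> (Basis :: 'a set)"
    show "continuous_on UNIV (\<lambda>t. f' (?T (v(b := t))) b)"
      unfolding Tupd[OF b]
      by (rule continuous_on_compose2[OF cont[OF b]]) (auto intro!: continuous_intros)
  next
    fix b assume b: "b \<in> (Basis :: 'a set)"
    show "(\<lambda>v. f' (?T v) b) \<in> borel_measurable ?P"
      by (rule measurable_compose[OF T f'm[OF b]])
  qed (use T in auto)
  also have "\<dots> \<le> 2 * (\<integral>\<^sup>+v. ennreal (K\<^sup>2) \<partial>?P)"
    using grad by (intro mult_left_mono nn_integral_mono) (auto intro!: ennreal_leI)
  also have "\<dots> = ennreal (2 * K\<^sup>2)"
    by (simp add: P.emeasure_space_1 ennreal_mult')
  finally show ?thesis .
qed

lemma integrable_std_gaussian_norm_square: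
  "integrable std_gaussian (\<lambda>x::'a::euclidean_space. (norm x)\<^sup>2)"
proof -
  let ?N = std_normal_measure
  let ?P = "PiM (Basis :: 'a set) (\<lambda>_. ?N)"
  let ?T = "\<lambda>v. \<Sum>b\<in>(Basis :: 'a set). v b *\<^sub>R b"
  have "integrable ?N (\<lambda>t. t\<^sup>2)"
    using integrable_std_normal_moment[of 2] by (subst integrable_density) auto
  then have 1: "integrable ?P (\<lambda>v. (v b)\<^sup>2)" if "b \<in> Basis" for b
    using distr_PiM_component[of Basis "\<lambda>_::'a. ?N" b] that prob_space_std_normal_measure
    by (intro integrable_distr[of "\<lambda>v. v b" ?P ?N]) auto
  have "(norm (?T v))\<^sup>2 = (\<Sum>b\<in>Basis. (v b)\<^sup>2)" for v
    unfolding power2_norm_eq_inner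
    by (subst euclidean_inner) (auto intro!: sum.cong simp: power2_eq_square)
  then show ?thesis
    using 1 unfolding std_gaussian_eq_distr_PiM by (subst integrable_distr_eq) auto
qed

text \<open>The basis vectors of the matrix type are \<open>axis i (axis j 1)\<close>, so reindexing
  by pairs identifies the joint law of the entries with the standard Gaussian. Integrals over
  \<open>M\<close> thereby become integrals over one fixed measure.\<close>

lemma iid_std_normal_matrix_distr:
  fixes A :: "'w \<Rightarrow> real ^ 'N::finite ^ 'n::finite"
  assumes "iid_std_normal_matrix M A"
  shows "A \<in> borel_measurable M" "distr M borel A = std_gaussian"
proof -
  interpret prob_space M using assms by (simp add: iid_std_normal_matrix_def)
  let ?N = std_normal_measure
  let ?e = "\<lambda>p::'n \<times> 'N. axis (fst p) (axis (snd p) (1::real))"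
  let ?X = "\<lambda>p \<omega>. A \<omega> $ fst p $ snd p"
  let ?G = "\<lambda>v. (\<chi> i j. v (i, j)) :: real ^ 'N ^ 'n"
  have ind: "indep_vars (\<lambda>_. borel) ?X UNIV"
    using assms by (simp add: iid_std_normal_matrix_def split_beta')
  have dist: "distributed M lborel (?X p) (\<lambda>t. ennreal (std_normal_density t))" for p
    using assms by (simp add: iid_std_normal_matrix_def)
  have X [measurable]: "?X p \<in> borel_measurable M" for p
    using distributed_measurable[OF dist[of p]] by simp
  have A: "A = (\<lambda>\<omega>. ?G (\<lambda>p\<in>UNIV. ?X p \<omega>))"
    by (auto simp: fun_eq_iff vec_eq_iff)
  have G [measurable]: "?G \<in> borel_measurable (PiM UNIV (\<lambda>_. ?N))"
    "?G \<in> borel_measurable (PiM UNIV (\<lambda>_. borel))"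
    by (subst borel_measurable_euclidean_space,
        force simp: Basis_vec_def inner_axis)+
  show Am: "A \<in> borel_measurable M"
    by (subst A) measurable
  have dX: "distr M borel (?X p) = ?N" for p
    using distributed_distr_eq_density[OF dist[of p]] by (simp cong: distr_cong)
  have law: "distr M (PiM UNIV (\<lambda>_. borel)) (\<lambda>\<omega>. \<lambda>p\<in>UNIV. ?X p \<omega>) = PiM UNIV (\<lambda>_. ?N)"
    using ind by (subst (asm) indep_vars_iff_distr_eq_PiM') (auto simp only: dX X UNIV_not_empty)
  have "PiM UNIV (\<lambda>_. ?N) = distr (PiM Basis (\<lambda>_. ?N)) (PiM UNIV (\<lambda>_. ?N)) (\<lambda>v. \<lambda>p\<in>UNIV. v (?e p))"
    by (rule distr_PiM_reindex[symmetric])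
      (auto intro: prob_space_std_normal_measure simp: inj_on_def axis_eq_axis axis_in_Basis_iff)
  then have "distr (PiM UNIV (\<lambda>_. ?N)) borel ?G
      = distr (distr (PiM Basis (\<lambda>_. ?N)) (PiM UNIV (\<lambda>_. ?N)) (\<lambda>v. \<lambda>p\<in>UNIV. v (?e p))) borel ?G"
    by simp
  also have "\<dots> = distr (PiM Basis (\<lambda>_. ?N)) borel (?G \<circ> (\<lambda>v. \<lambda>p\<in>UNIV. v (?e p)))"
    by (rule distr_distr) (auto intro!: G measurable_restrict measurable_component_singleton)
  also have "?G \<circ> (\<lambda>v. \<lambda>p\<in>UNIV. v (?e p)) = (\<lambda>v. \<Sum>b\<in>Basis. v b *\<^sub>R b)"
  proof (rule ext, rule euclidean_eqI)
    fix v and b :: "real ^ 'N ^ 'n" assume b: "b \<in> Basis"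
    then obtain i j where "b = axis i (axis j 1)" by (auto simp: Basis_vec_def)
    then have "(?G \<circ> (\<lambda>v. \<lambda>p\<in>UNIV. v (?e p))) v \<bullet> b = v b"
      by (simp add: inner_axis)
    also have "\<dots> = (\<Sum>b\<in>Basis. v b *\<^sub>R b) \<bullet> b"
      by (rule inner_sum_left_Basis[OF b, symmetric])
    finally show "(?G \<circ> (\<lambda>v. \<lambda>p\<in>UNIV. v (?e p))) v \<bullet> b = (\<Sum>b\<in>Basis. v b *\<^sub>R b) \<bullet> b" .
  qed
  also have "distr (PiM Basis (\<lambda>_. ?N)) borel (\<lambda>v. \<Sum>b\<in>Basis. v b *\<^sub>R b) = std_gaussian"
    by (rule std_gaussian_eq_distr_PiM[symmetric])
  finally have "distr (PiM UNIV (\<lambda>_. ?N)) borel ?G = std_gaussian" .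
  moreover have "distr M borel A = distr (PiM UNIV (\<lambda>_. ?N)) borel ?G"
    unfolding law[symmetric] by (subst distr_distr) (auto simp: comp_def A[symmetric])
  ultimately show "distr M borel A = std_gaussian" by simp
qed

section \<open>Distance to the nearest codeword\<close>

text \<open>Fatou's lemma, once for each variable; the integrand is nonnegative, so no domination is
  required.\<close>

lemma sq_spread_LIMSEQ_le:
  assumes "sigma_finite_measure M" and m [measurable]: "\<And>k. f k \<in> borel_measurable M"
    and lim: "\<And>x. (\<lambda>k. f k x) \<longlonglongrightarrow> g x" and le: "\<And>k. sq_spread M (f k) \<le> K"
  shows "sq_spread M g \<le> K"
proof -
  interpret sigma_finite_measure M by fact
  let ?q = "\<lambda>k x y. ennreal ((f k x - f k y)\<^sup>2)"
  have "ennreal ((g x - g y)\<^sup>2) = liminf (\<lambda>k. ?q k x y)" for x y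
    by (rule lim_imp_Liminf[symmetric]) (auto intro!: tendsto_ennrealI tendsto_intros lim)
  then have "sq_spread M g = (\<integral>\<^sup>+x. \<integral>\<^sup>+y. liminf (\<lambda>k. ?q k x y) \<partial>M \<partial>M)"
    unfolding sq_spread_def by simp
  also have "\<dots> \<le> (\<integral>\<^sup>+x. liminf (\<lambda>k. \<integral>\<^sup>+y. ?q k x y \<partial>M) \<partial>M)"
    by (intro nn_integral_mono nn_integral_liminf) measurable
  also have "\<dots> \<le> liminf (\<lambda>k. \<integral>\<^sup>+x. \<integral>\<^sup>+y. ?q k x y \<partial>M \<partial>M)"
    by (intro nn_integral_liminf) measurable
  also have "\<dots> \<le> liminf (\<lambda>k::nat. K)"
    by (intro Liminf_mono always_eventually allI) (use le in \<open>simp add: sq_spread_def\<close>)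
  finally show ?thesis by (simp add: Liminf_const)
qed

text \<open>With mean \<open>m\<close> and variance \<open>V\<close>, integrating out
  \<open>y\<close> leaves \<open>(f x - m)\<^sup>2 + V\<close>, because the cross term has mean
  0.\<close>

lemma sq_spread_eq_variance:
  assumes "prob_space M" and f: "integrable M f" "integrable M (\<lambda>x. (f x)\<^sup>2)"
  shows "sq_spread M f = ennreal (2 * (\<integral>x. (f x - (\<integral>y. f y \<partial>M))\<^sup>2 \<partial>M))"
proof -
  interpret prob_space M by fact
  define m where "m = (\<integral>y. f y \<partial>M)"
  have i: "integrable M (\<lambda>x. (f x - a)\<^sup>2)" for a
    using f unfolding power2_diff by auto
  define V where "V = (\<integral>x. (f x - m)\<^sup>2 \<partial>M)"
  have V0: "0 \<le> V" unfolding V_def by (intro Bochner_Integration.integral_nonneg) auto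
  have "(\<integral>\<^sup>+y. ennreal ((f x - f y)\<^sup>2) \<partial>M) = ennreal ((f x - m)\<^sup>2 + V)" for x
  proof -
    have "(\<integral>\<^sup>+y. ennreal ((f x - f y)\<^sup>2) \<partial>M) = ennreal (\<integral>y. (f x - f y)\<^sup>2 \<partial>M)"
      using i[of "f x"] by (intro nn_integral_eq_integral) (auto simp: power2_commute)
    also have "(\<integral>y. (f x - f y)\<^sup>2 \<partial>M)
        = (\<integral>y. (f x - m)\<^sup>2 + (f y - m)\<^sup>2 - 2 * (f x - m) * (f y - m) \<partial>M)"
      by (intro Bochner_Integration.integral_cong refl) (simp add: power2_eq_square algebra_simps)
    also have "\<dots> = (f x - m)\<^sup>2 + V"
      using f i[of m] prob_space
      by (simp add: V_def m_def)
    finally show ?thesis .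
  qed
  then have "sq_spread M f = (\<integral>\<^sup>+x. ennreal ((f x - m)\<^sup>2 + V) \<partial>M)"
    unfolding sq_spread_def by simp
  also have "\<dots> = ennreal (\<integral>x. (f x - m)\<^sup>2 + V \<partial>M)"
    using i[of m] V0 by (intro nn_integral_eq_integral) auto
  also have "(\<integral>x. (f x - m)\<^sup>2 + V \<partial>M) = 2 * V"
    using i[of m] prob_space by (simp add: V_def)
  finally show ?thesis unfolding V_def m_def .
qed

text \<open>Cauchy-Schwarz in each row: the norm of the nested vector type is the Frobenius norm. It
  is the reason why \<open>norm b\<close> is a Lipschitz constant in the matrix.\<close>

lemma norm_matrix_vector_mult_le:
  fixes A :: "real ^ 'm::finite ^ 'n::finite"
  shows "norm (A *v x) \<le> norm A * norm x"
proof -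
  have "norm (A *v x) = L2_set (\<lambda>i. norm (A $ i \<bullet> x)) UNIV"
    unfolding norm_vec_def by (simp add: matrix_vector_mul_component)
  also have "\<dots> \<le> L2_set (\<lambda>i. norm x * norm (A $ i)) UNIV"
    using Cauchy_Schwarz_ineq2[of "A $ i" x for i]
    by (intro L2_set_mono) (simp_all add: mult.commute)
  also have "\<dots> = norm A * norm x"
    by (simp add: L2_set_right_distrib[symmetric] norm_vec_def[of A])
  finally show ?thesis .
qed

lemma bounded_linear_matrix_vector_mult_left:
  "bounded_linear (\<lambda>A. (A :: real ^ 'm::finite ^ 'n::finite) *v x)"
  by (intro bounded_linear_intro[where K="norm x"])
    (auto simp: matrix_vector_mult_add_rdistrib scaleR_matrix_vector_assoc norm_matrix_vector_mult_le)

definition min_distance :: "(real ^ 'm::finite) set \<Rightarrow> real ^ 'n::finite \<Rightarrow> real ^ 'm ^ 'n \<Rightarrow> real" where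
  "min_distance S r A = Min ((\<lambda>b. norm (r - A *v b)) ` S)"

text \<open>The Poincare inequality above needs a differentiable function; the soft minimum of smoothed
  norms has gradient bounded by the largest \<open>norm b\<close>, uniformly in \<open>d\<close>.\<close>

definition smooth_norm :: "real \<Rightarrow> 'a::real_inner \<Rightarrow> real" where
  "smooth_norm d y = sqrt (d\<^sup>2 + y \<bullet> y)"

text \<open>Log-sum-exp at temperature \<open>d\<close>. The same parameter rounds off the norm at
  0, so that one limit removes both smoothings.\<close>

definition softmin_distance ::
    "real \<Rightarrow> (real ^ 'm::finite) set \<Rightarrow> real ^ 'n::finite \<Rightarrow> real ^ 'm ^ 'n \<Rightarrow> real" where
  "softmin_distance d S r A = - d * ln (\<Sum>b\<in>S. exp (- smooth_norm d (r - A *v b) / d))"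

lemma smooth_norm_pos: "d > 0 \<Longrightarrow> smooth_norm d y > 0"
  unfolding smooth_norm_def by (simp add: add_pos_nonneg)

lemma norm_le_smooth_norm: "norm y \<le> smooth_norm d y"
  unfolding smooth_norm_def norm_eq_sqrt_inner by simp

lemma smooth_norm_le: "d > 0 \<Longrightarrow> smooth_norm d y \<le> d + norm y"
  unfolding smooth_norm_def power2_norm_eq_inner[symmetric]
  by (intro real_le_lsqrt) (auto simp: power2_sum)

lemma smooth_norm_has_derivative:
  assumes "d > 0"
  shows "((\<lambda>A. smooth_norm d (r - (A :: real ^ 'm::finite ^ 'n::finite) *v b)) has_derivative
    (\<lambda>H. - ((r - A *v b) \<bullet> (H *v b)) / smooth_norm d (r - A *v b))) (at A)"
proof -
  have *: "((\<lambda>A. A *v b) has_derivative (\<lambda>H. H *v b)) (at A)"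
    by (rule bounded_linear_imp_has_derivative[OF bounded_linear_matrix_vector_mult_left])
  have pos: "d\<^sup>2 + (r - A *v b) \<bullet> (r - A *v b) > 0"
    using assms by (intro add_pos_nonneg) auto
  show ?thesis
    unfolding smooth_norm_def using pos
    by (auto intro!: derivative_eq_intros * simp: fun_eq_iff inner_commute field_simps)
qed

text \<open>The derivative is a weighted average of those of the smoothed distances, with positive
  weights; a common bound for them is inherited without loss.\<close>

lemma softmin_distance_has_derivative:
  assumes "finite S" "S \<noteq> {}" "d > 0"
  shows "(softmin_distance d S r has_derivative
    (\<lambda>H. (\<Sum>b\<in>S. exp (- smooth_norm d (r - A *v b) / d)
        * (- ((r - A *v b) \<bullet> (H *v b)) / smooth_norm d (r - A *v b)))
      / (\<Sum>b\<in>S. exp (- smooth_norm d (r - A *v b) / d)))) (at A)"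
proof -
  have pos: "(\<Sum>b\<in>S. exp (- smooth_norm d (r - A *v b) / d)) > 0"
    using assms by (intro sum_pos) auto
  have *: "((\<lambda>A. \<Sum>b\<in>S. exp (- smooth_norm d (r - A *v b) / d)) has_derivative
     (\<lambda>H. \<Sum>b\<in>S. exp (- smooth_norm d (r - A *v b) / d)
        * (- (- ((r - A *v b) \<bullet> (H *v b)) / smooth_norm d (r - A *v b)) / d))) (at A)"
    using \<open>d > 0\<close>
    by (intro has_derivative_sum)
      (auto intro!: derivative_eq_intros smooth_norm_has_derivative simp: fun_eq_iff)
  have "(\<Sum>b\<in>S. exp (- smooth_norm d (r - A *v b) / d)
        * (- (- ((r - A *v b) \<bullet> (H *v b)) / smooth_norm d (r - A *v b)) / d))
      = - (\<Sum>b\<in>S. exp (- smooth_norm d (r - A *v b) / d)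
        * (- ((r - A *v b) \<bullet> (H *v b)) / smooth_norm d (r - A *v b))) / d" for H
    by (simp add: sum_divide_distrib sum_negf)
  note eq = this
  have "- d * (- a / d * inverse z) = a / z" for a z
    using \<open>d > 0\<close> by (simp add: divide_inverse)
  then show ?thesis
    unfolding softmin_distance_def [abs_def]
    using has_derivative_mult_right[OF has_derivative_ln[OF pos *], of "- d"]
    unfolding eq by simp
qed

lemma sq_spread_softmin_distance_le:
  fixes r :: "real ^ 'n::finite" and S :: "(real ^ 'm::finite) set"
  assumes S: "finite S" "S \<noteq> {}" and "d > 0" and c: "\<And>b. b \<in> S \<Longrightarrow> norm b \<le> c"
  shows "sq_spread std_gaussian (softmin_distance d S r) \<le> ennreal (2 * c\<^sup>2)"
proof (rule sq_spread_std_gaussian_le[OF softmin_distance_has_derivative[OF S \<open>d > 0\<close>]])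
  let ?w = "\<lambda>A b. exp (- smooth_norm d (r - A *v b) / d)"
  have pos: "(\<Sum>b\<in>S. ?w A b) > 0" for A :: "real ^ 'm ^ 'n"
    using S by (intro sum_pos) auto
  have cq: "continuous_on UNIV (\<lambda>A :: real ^ 'm ^ 'n. smooth_norm d (r - A *v b))" for b
    using smooth_norm_has_derivative[OF \<open>d > 0\<close>] has_derivative_continuous
    by (intro continuous_at_imp_continuous_on) blast
  have cl: "continuous_on UNIV (\<lambda>A :: real ^ 'm ^ 'n. A *v b)" for b
    by (rule linear_continuous_on[OF bounded_linear_matrix_vector_mult_left])
  fix H :: "real ^ 'm ^ 'n"
  show "continuous_on UNIV (\<lambda>A. (\<Sum>b\<in>S. ?w A b * (- ((r - A *v b) \<bullet> (H *v b)) / smooth_norm d (r - A *v b)))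
      / (\<Sum>b\<in>S. ?w A b))"
  proof (intro continuous_on_divide)
    show "\<forall>A\<in>UNIV. (\<Sum>b\<in>S. ?w A b) \<noteq> 0" using pos less_imp_neq by (metis)
    show "continuous_on UNIV (\<lambda>A. \<Sum>b\<in>S. ?w A b)"
      using \<open>d > 0\<close> by (intro continuous_intros cq) auto
    have nz: "\<forall>A\<in>UNIV. smooth_norm d (r - (A :: real ^ 'm ^ 'n) *v b) \<noteq> 0" for b
      using smooth_norm_pos[OF \<open>d > 0\<close>] less_imp_neq by metis
    show "continuous_on UNIV (\<lambda>A. \<Sum>b\<in>S. ?w A b * (- ((r - A *v b) \<bullet> (H *v b)) / smooth_norm d (r - A *v b)))"
      using \<open>d > 0\<close> by (intro continuous_intros cq cl nz) auto
  qed
  fix A :: "real ^ 'm ^ 'n"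
  \<comment> \<open>Smoothing only enlarges the denominator beyond the norm of the residual, so at
    most \<open>norm (H *v b)\<close> remains.\<close>
  have q: "\<bar>- ((r - A *v b) \<bullet> (H *v b)) / smooth_norm d (r - A *v b)\<bar> \<le> c * norm H" if "b \<in> S" for b
  proof -
    have "\<bar>(r - A *v b) \<bullet> (H *v b)\<bar> \<le> norm (r - A *v b) * norm (H *v b)"
      by (rule Cauchy_Schwarz_ineq2)
    also have "\<dots> \<le> smooth_norm d (r - A *v b) * (norm H * norm b)"
      by (intro mult_mono norm_le_smooth_norm norm_matrix_vector_mult_le) (auto intro: less_imp_le smooth_norm_pos \<open>d > 0\<close>)
    also have "\<dots> \<le> smooth_norm d (r - A *v b) * (norm H * c)"
      using c[OF that] smooth_norm_pos[OF \<open>d > 0\<close>, of "r - A *v b"] by (intro mult_left_mono) auto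
    finally show ?thesis
      using smooth_norm_pos[OF \<open>d > 0\<close>, of "r - A *v b"] by (simp add: abs_divide divide_le_eq mult.commute mult.left_commute)
  qed
  have "\<bar>\<Sum>b\<in>S. ?w A b * (- ((r - A *v b) \<bullet> (H *v b)) / smooth_norm d (r - A *v b))\<bar>
      \<le> (\<Sum>b\<in>S. ?w A b * (c * norm H))"
    by (rule order_trans[OF sum_abs])
      (auto intro!: sum_mono mult_left_mono q simp only: abs_mult abs_exp_cancel exp_ge_zero)
  also have "\<dots> = (c * norm H) * (\<Sum>b\<in>S. ?w A b)"
    by (simp add: sum_distrib_left mult.commute)
  finally show "\<bar>(\<Sum>b\<in>S. ?w A b * (- ((r - A *v b) \<bullet> (H *v b)) / smooth_norm d (r - A *v b)))
      / (\<Sum>b\<in>S. ?w A b)\<bar> \<le> c * norm H"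
    using pos[of A] by (simp only: abs_divide abs_of_pos pos_divide_le_eq)
qed

text \<open>The sum of exponentials is at most \<open>card S\<close> times its largest possible
  term, and at least the term of a nearest codeword. The first estimate costs
  \<open>d * ln (card S)\<close>; the rounding of the norm costs \<open>d\<close> in the
  second.\<close>

lemma softmin_distance_bounds:
  assumes S: "finite S" "S \<noteq> {}" and "d > 0"
  shows "min_distance S r A - d * ln (card S) \<le> softmin_distance d S r A"
    and "softmin_distance d S r A \<le> min_distance S r A + d"
proof -
  let ?w = "\<lambda>b. exp (- smooth_norm d (r - A *v b) / d)" and ?m = "min_distance S r A"
  have pos: "(\<Sum>b\<in>S. ?w b) > 0" using S by (intro sum_pos) auto
  have card: "real (card S) > 0" using S by (simp add: card_gt_0_iff)
  have "(\<Sum>b\<in>S. ?w b) \<le> (\<Sum>b\<in>S. exp (- ?m / d))"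
  proof (rule sum_mono)
    fix b assume "b \<in> S"
    then have "?m \<le> norm (r - A *v b)" unfolding min_distance_def using S by (intro Min_le) auto
    also have "\<dots> \<le> smooth_norm d (r - A *v b)" by (rule norm_le_smooth_norm)
    finally show "?w b \<le> exp (- ?m / d)" using \<open>d > 0\<close> by (simp add: divide_right_mono)
  qed
  also have "\<dots> = card S * exp (- ?m / d)" by simp
  finally have "ln (\<Sum>b\<in>S. ?w b) \<le> ln (card S * exp (- ?m / d))"
    using pos card by (subst ln_le_cancel_iff) auto
  also have "\<dots> = ln (card S) - ?m / d" using card by (simp add: ln_mult)
  finally have "d * ln (\<Sum>b\<in>S. ?w b) \<le> d * (ln (card S) - ?m / d)"
    using \<open>d > 0\<close> by simp
  then show "?m - d * ln (card S) \<le> softmin_distance d S r A"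
    using \<open>d > 0\<close> by (simp add: softmin_distance_def algebra_simps)
  have "?m \<in> (\<lambda>b. norm (r - A *v b)) ` S"
    unfolding min_distance_def using S by (intro Min_in) auto
  then obtain b where b: "b \<in> S" "?m = norm (r - A *v b)" by auto
  have "- smooth_norm d (r - A *v b) / d = ln (?w b)" by simp
  also have "\<dots> \<le> ln (\<Sum>b\<in>S. ?w b)"
    using pos b S by (subst ln_le_cancel_iff) (auto intro!: member_le_sum)
  finally have "softmin_distance d S r A \<le> smooth_norm d (r - A *v b)"
    using \<open>d > 0\<close> by (simp add: softmin_distance_def field_simps)
  then show "softmin_distance d S r A \<le> ?m + d"
    using smooth_norm_le[OF \<open>d > 0\<close>, of "r - A *v b"] b by simp
qed

text \<open>The bound for soft minima does not involve their parameter, so it survives the pointwise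
  limit as that parameter tends to 0.\<close>

lemma sq_spread_min_distance_le:
  fixes r :: "real ^ 'n::finite" and S :: "(real ^ 'm::finite) set"
  assumes S: "finite S" "S \<noteq> {}" and c: "\<And>b. b \<in> S \<Longrightarrow> norm b \<le> c"
  shows "sq_spread std_gaussian (min_distance S r) \<le> ennreal (2 * c\<^sup>2)"
proof (rule sq_spread_LIMSEQ_le)
  let ?d = "\<lambda>k. inverse (real (Suc k))"
  show "sigma_finite_measure (std_gaussian :: (real ^ 'm ^ 'n) measure)"
    by (intro finite_measure.sigma_finite_measure prob_space.finite_measure prob_space_std_gaussian)
  show "softmin_distance (?d k) S r \<in> borel_measurable std_gaussian" for k
  proof -
    have "continuous_on UNIV (softmin_distance (?d k) S r)"
      using softmin_distance_has_derivative[OF S, of "?d k" r] has_derivative_continuous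
      by (intro continuous_at_imp_continuous_on) force
    then have "softmin_distance (?d k) S r \<in> borel_measurable borel"
      by (rule borel_measurable_continuous_onI)
    then show ?thesis by (subst measurable_cong_sets[OF sets_std_gaussian refl])
  qed
  show "sq_spread std_gaussian (softmin_distance (?d k) S r) \<le> ennreal (2 * c\<^sup>2)" for k
    by (rule sq_spread_softmin_distance_le) (use S c in auto)
  show "(\<lambda>k. softmin_distance (?d k) S r A) \<longlonglongrightarrow> min_distance S r A" for A
  proof (rule tendsto_sandwich)
    show "\<forall>\<^sub>F k in sequentially. min_distance S r A - ?d k * ln (card S) \<le> softmin_distance (?d k) S r A"
      by (intro always_eventually allI softmin_distance_bounds S) simp
    show "\<forall>\<^sub>F k in sequentially. softmin_distance (?d k) S r A \<le> min_distance S r A + ?d k"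
      by (intro always_eventually allI softmin_distance_bounds S) simp
    have "(\<lambda>k. min_distance S r A - ?d k * ln (card S)) \<longlonglongrightarrow> min_distance S r A - 0 * ln (card S)"
      by (intro tendsto_intros LIMSEQ_inverse_real_of_nat)
    then show "(\<lambda>k. min_distance S r A - ?d k * ln (card S)) \<longlonglongrightarrow> min_distance S r A" by simp
    have "(\<lambda>k. min_distance S r A + ?d k) \<longlonglongrightarrow> min_distance S r A + 0"
      by (intro tendsto_intros LIMSEQ_inverse_real_of_nat)
    then show "(\<lambda>k. min_distance S r A + ?d k) \<longlonglongrightarrow> min_distance S r A" by simp
  qed
qed

section \<open>Moments, rotation invariance and positivity of the mean distance\<close>

lemma borel_measurable_min_distance [measurable (raw)]:
  assumes "finite S"
    and f: "f \<in> borel_measurable M"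
    and g: "g \<in> borel_measurable M"
  shows "(\<lambda>x. min_distance S (f x) (g x :: real ^ 'm::finite ^ 'n::finite)) \<in> borel_measurable M"
proof -
  have "(\<lambda>x. g x *v b) \<in> borel_measurable M" for b
    by (rule measurable_compose[OF g borel_measurable_continuous_onI])
      (rule linear_continuous_on[OF bounded_linear_matrix_vector_mult_left])
  then show ?thesis
    unfolding min_distance_def using assms
    by (intro borel_measurable_Min borel_measurable_norm borel_measurable_diff) auto
qed

lemma min_distance_nonneg: "finite S \<Longrightarrow> S \<noteq> {} \<Longrightarrow> 0 \<le> min_distance S r A"
  unfolding min_distance_def by simp

lemma min_distance_le:
  assumes "finite S" "b \<in> S"
  shows "min_distance S r A \<le> norm (r - A *v b)"
  unfolding min_distance_def using assms by simp

lemma min_distance_attained: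
  assumes "finite S" "S \<noteq> {}"
  obtains b where "b \<in> S" "min_distance S r A = norm (r - A *v b)"
proof -
  have "min_distance S r A \<in> (\<lambda>b. norm (r - A *v b)) ` S"
    unfolding min_distance_def using assms by (intro Min_in) auto
  then show thesis using that by blast
qed

lemma min_distance_le_norm:
  assumes "finite S" "S \<noteq> {}" "\<And>b. b \<in> S \<Longrightarrow> norm b \<le> c"
  shows "min_distance S r A \<le> norm r + c * norm A"
proof -
  obtain b where b: "b \<in> S" using assms by auto
  have "min_distance S r A \<le> norm (r - A *v b)" using assms b by (intro min_distance_le)
  also have "\<dots> \<le> norm r + norm A * norm b"
    using norm_triangle_ineq4[of r "A *v b"] norm_matrix_vector_mult_le[of A b] by linarith
  also have "norm A * norm b \<le> c * norm A"
    using mult_left_mono[OF assms(3)[OF b], of "norm A"] by (simp add: mult.commute)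
  finally show ?thesis by simp
qed

lemma min_distance_lipschitz:
  assumes S: "finite S" "S \<noteq> {}"
  shows "\<bar>min_distance S r A - min_distance S r' A\<bar> \<le> norm (r - r')"
proof -
  have *: "min_distance S u A \<le> min_distance S v A + norm (u - v)" for u v
  proof -
    obtain b where b: "b \<in> S" "min_distance S v A = norm (v - A *v b)"
      using min_distance_attained[OF S] .
    have "min_distance S u A \<le> norm (u - A *v b)" using S b by (intro min_distance_le)
    also have "\<dots> \<le> norm (u - v) + norm (v - A *v b)"
      using norm_triangle_ineq[of "u - v" "v - A *v b"] by simp
    finally show ?thesis using b by simp
  qed
  show ?thesis using *[of r r'] *[of r' r] by (simp add: norm_minus_commute)
qed

lemma integrable_norm_std_gaussian: "integrable std_gaussian (\<lambda>x::'a::euclidean_space. norm x)"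
proof (rule Bochner_Integration.integrable_bound)
  interpret prob_space "std_gaussian :: 'a measure" by (rule prob_space_std_gaussian)
  show "integrable std_gaussian (\<lambda>x::'a. 1 + (norm x)\<^sup>2)"
    by (intro Bochner_Integration.integrable_add integrable_std_gaussian_norm_square) simp
  have "t \<le> 1 + t\<^sup>2" for t :: real
    using zero_le_power2[of "t - 1/2"] unfolding power2_diff by (simp add: power2_eq_square)
  then show "AE x::'a in std_gaussian. norm (norm x) \<le> norm (1 + (norm x)\<^sup>2)"
    by simp
qed measurable

lemma integrable_std_gaussian_linear_growth:
  fixes f :: "'a::euclidean_space \<Rightarrow> real"
  assumes [measurable]: "f \<in> borel_measurable borel" and f: "\<And>x. \<bar>f x\<bar> \<le> a + b * norm x"
  shows "integrable std_gaussian f" "integrable std_gaussian (\<lambda>x. (f x)\<^sup>2)"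
proof -
  interpret prob_space "std_gaussian :: 'a measure" by (rule prob_space_std_gaussian)
  show "integrable std_gaussian f"
    by (rule Bochner_Integration.integrable_bound[of _ "\<lambda>x. a + b * norm x"])
      (use integrable_norm_std_gaussian[where 'a='a] f in \<open>auto intro: order_trans[OF _ abs_ge_self]\<close>)
  show "integrable std_gaussian (\<lambda>x. (f x)\<^sup>2)"
  proof (rule Bochner_Integration.integrable_bound)
    show "integrable std_gaussian (\<lambda>x. (a + b * norm (x::'a))\<^sup>2)"
      unfolding power2_sum power_mult_distrib
      using integrable_norm_std_gaussian[where 'a='a] integrable_std_gaussian_norm_square[where 'a='a]
      by (auto simp: mult.assoc)
    have "(f x)\<^sup>2 \<le> (a + b * norm x)\<^sup>2" for x
      using power_mono[OF f[of x], of 2] by simp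
    then show "AE x in std_gaussian. norm ((f x)\<^sup>2) \<le> norm ((a + b * norm x)\<^sup>2)"
      by simp
  qed measurable
qed

lemma integrable_min_distance:
  fixes S :: "(real ^ 'm::finite) set" and r :: "real ^ 'n::finite"
  assumes S: "finite S" "S \<noteq> {}"
  shows "integrable std_gaussian (min_distance S r)"
    "integrable std_gaussian (\<lambda>A. (min_distance S r A)\<^sup>2)"
proof -
  define c where "c = Max (norm ` S)"
  have c: "norm b \<le> c" if "b \<in> S" for b unfolding c_def using S that by simp
  have m: "min_distance S r \<in> borel_measurable borel" using S(1) by measurable
  have "\<bar>min_distance S r A\<bar> \<le> norm r + c * norm A" for A
    using min_distance_nonneg[OF S, of r A] min_distance_le_norm[OF S c, of r A] by linarith
  from integrable_std_gaussian_linear_growth[OF m this]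
  show "integrable std_gaussian (min_distance S r)"
    "integrable std_gaussian (\<lambda>A. (min_distance S r A)\<^sup>2)" .
qed

lemma variance_min_distance_le:
  fixes r :: "real ^ 'n::finite" and S :: "(real ^ 'm::finite) set"
  assumes S: "finite S" "S \<noteq> {}" and c: "\<And>b. b \<in> S \<Longrightarrow> norm b \<le> c"
  shows "(\<integral>A. (min_distance S r A - (\<integral>A. min_distance S r A \<partial>std_gaussian))\<^sup>2 \<partial>std_gaussian) \<le> c\<^sup>2"
  using sq_spread_min_distance_le[OF S c, of r]
    sq_spread_eq_variance[OF prob_space_std_gaussian integrable_min_distance[OF S, of r]]
  by simp

text \<open>The squared norm of a matrix is the sum of the squared norms of its columns, and each
  column is rotated by \<open>U\<close>.\<close>

lemma left_mult_orthogonal_transformation: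
  fixes U :: "real ^ 'n::finite \<Rightarrow> real ^ 'n"
  assumes U: "orthogonal_transformation U"
  shows "orthogonal_transformation (\<lambda>A :: real ^ 'm::finite ^ 'n. matrix U ** A)"
  unfolding orthogonal_transformation
proof (intro conjI allI)
  show "linear (\<lambda>A :: real ^ 'm ^ 'n. matrix U ** A)"
    by (rule linearI)
      (auto simp: matrix_matrix_mult_def vec_eq_iff sum.distrib sum_distrib_left algebra_simps)
  fix A :: "real ^ 'm ^ 'n"
  have lin: "linear U" using U by (simp add: orthogonal_transformation_def)
  have sq: "(norm B)\<^sup>2 = (\<Sum>j\<in>UNIV. (norm (column j B))\<^sup>2)" for B :: "real ^ 'm ^ 'n"
    unfolding power2_norm_eq_inner inner_vec_def column_def
    by (subst sum.swap) simp
  have "column j (matrix U ** A) = matrix U *v column j A" for j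
    by (simp add: vec_eq_iff column_def matrix_matrix_mult_def matrix_vector_mult_def)
  then have "column j (matrix U ** A) = U (column j A)" for j
    by (simp add: fun_cong[OF matrix_vector_mul(2)[OF lin]])
  then have "(norm (matrix U ** A))\<^sup>2 = (norm A)\<^sup>2"
    by (simp add: sq orthogonal_transformation_norm[OF U])
  then show "norm (matrix U ** A) = norm A" by simp
qed

text \<open>A rotation \<open>U\<close> with \<open>U r = r'\<close> may be applied to the matrix as
  well, since this leaves the Gaussian law unchanged.\<close>

lemma integral_min_distance_cong_norm:
  fixes r r' :: "real ^ 'n::finite" and S :: "(real ^ 'm::finite) set"
  assumes S: "finite S" and n: "norm r = norm r'"
  shows "(\<integral>A. min_distance S r A \<partial>std_gaussian) = (\<integral>A. min_distance S r' A \<partial>std_gaussian)"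
proof -
  obtain U where U: "orthogonal_transformation U" "U r = r'"
    using orthogonal_transformation_exists[OF n] .
  have lin: "linear U" using U by (simp add: orthogonal_transformation_def)
  note [measurable] = borel_measurable_orthogonal_transformation[OF left_mult_orthogonal_transformation[OF U(1)]]
  have "min_distance S r' (matrix U ** A) = min_distance S r A" for A :: "real ^ 'm ^ 'n"
  proof -
    have "norm (r' - (matrix U ** A) *v b) = norm (r - A *v b)" for b
    proof -
      have "r' - (matrix U ** A) *v b = U (r - A *v b)"
        by (simp add: U linear_diff[OF lin] matrix_vector_mul_assoc[symmetric] fun_cong[OF matrix_vector_mul(2)[OF lin]])
      then show ?thesis by (simp add: orthogonal_transformation_norm[OF U(1)])
    qed
    then show ?thesis unfolding min_distance_def by simp
  qed
  then have "(\<integral>A. min_distance S r A \<partial>std_gaussian)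
      = (\<integral>A. min_distance S r' (matrix U ** A) \<partial>(std_gaussian :: (real ^ 'm ^ 'n) measure))"
    by simp
  also have "\<dots> = (\<integral>A. min_distance S r' A \<partial>distr std_gaussian borel (\<lambda>A. matrix U ** A))"
    using S by (intro integral_distr[symmetric]) measurable
  finally show ?thesis
    by (simp add: distr_std_gaussian_orthogonal_transformation[OF left_mult_orthogonal_transformation[OF U(1)]])
qed

text \<open>By rotation invariance both vectors may first be moved to a common ray, where their
  distance shrinks to the difference of their norms; only then is the pointwise Lipschitz bound
  applied.\<close>

lemma integral_min_distance_lipschitz:
  fixes r r' :: "real ^ 'n::finite" and S :: "(real ^ 'm::finite) set"
  assumes S: "finite S" "S \<noteq> {}"
  shows "\<bar>(\<integral>A. min_distance S r A \<partial>std_gaussian) - (\<integral>A. min_distance S r' A \<partial>std_gaussian)\<bar>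
    \<le> \<bar>norm r - norm r'\<bar>"
proof -
  interpret prob_space "std_gaussian :: (real ^ 'm ^ 'n) measure" by (rule prob_space_std_gaussian)
  define e :: "real ^ 'n" where "e = axis undefined 1"
  let ?u = "norm r *\<^sub>R e" and ?u' = "norm r' *\<^sub>R e"
  have e: "norm e = 1" by (simp add: e_def)
  have "\<bar>(\<integral>A. min_distance S ?u A \<partial>std_gaussian) - (\<integral>A. min_distance S ?u' A \<partial>std_gaussian)\<bar>
      = \<bar>\<integral>A. min_distance S ?u A - min_distance S ?u' A \<partial>std_gaussian\<bar>"
    using integrable_min_distance[OF S] by (subst Bochner_Integration.integral_diff) auto
  also have "\<dots> \<le> (\<integral>A. \<bar>min_distance S ?u A - min_distance S ?u' A\<bar> \<partial>std_gaussian)"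
    by (rule integral_abs_bound)
  also have "\<dots> \<le> (\<integral>A. norm (?u - ?u') \<partial>(std_gaussian :: (real ^ 'm ^ 'n) measure))"
    by (intro integral_mono min_distance_lipschitz S integrable_abs
        Bochner_Integration.integrable_diff integrable_min_distance) auto
  also have "\<dots> = \<bar>norm r - norm r'\<bar>"
    using prob_space by (simp add: scaleR_diff_left[symmetric] e del: scaleR_diff_left)
  finally show ?thesis
    using integral_min_distance_cong_norm[OF S(1), of r ?u] integral_min_distance_cong_norm[OF S(1), of r' ?u'] e
    by simp
qed

text \<open>The equation for a single row already confines \<open>A\<close> to a hyperplane, which
  is a null set.\<close>

lemma AE_std_gaussian_matrix_vector_neq:
  fixes b :: "real ^ 'm::finite" and v :: "real ^ 'n::finite"
  assumes "b \<noteq> 0"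
  shows "AE A in std_gaussian. A *v b \<noteq> v"
proof -
  define i :: 'n where "i = undefined"
  have "axis i b \<noteq> 0" using assms by (simp add: axis_eq_0_iff)
  then have "negligible {A :: real ^ 'm ^ 'n. axis i b \<bullet> A = v $ i}"
    by (intro negligible_hyperplane) simp
  then have n: "{A :: real ^ 'm ^ 'n. axis i b \<bullet> A = v $ i} \<in> null_sets lborel"
    by (subst (asm) negligible_iff_null_sets) (simp add: null_sets_completion_iff)
  have "AE A in lborel. A *v b \<noteq> v"
  proof (rule AE_mp[OF AE_not_in[OF n]], rule AE_I2, rule impI, rule notI)
    fix A :: "real ^ 'm ^ 'n" assume A: "A \<notin> {A. axis i b \<bullet> A = v $ i}" and eq: "A *v b = v"
    have "v $ i = A $ i \<bullet> b" unfolding eq[symmetric] by (rule matrix_vector_mul_component)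
    with A show False using inner_axis'[of i b A] by (simp only: mem_Collect_eq inner_commute)
  qed
  then show ?thesis
    unfolding std_gaussian_def by (subst AE_density) (auto intro!: borel_measurable_prod_ennreal)
qed

lemma integral_min_distance_pos:
  fixes S :: "(real ^ 'm::finite) set" and r :: "real ^ 'n::finite"
  assumes S: "finite S" "S \<noteq> {}" and nz: "0 \<notin> S"
  shows "0 < (\<integral>A. min_distance S r A \<partial>std_gaussian)"
proof -
  interpret prob_space "std_gaussian :: (real ^ 'm ^ 'n) measure" by (rule prob_space_std_gaussian)
  have "AE A in std_gaussian. \<forall>b\<in>S. A *v b \<noteq> r"
    using S nz by (intro AE_finite_allI AE_std_gaussian_matrix_vector_neq) auto
  then have "AE A in std_gaussian. 0 < min_distance S r A"
  proof eventually_elim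
    case (elim A)
    obtain b where "b \<in> S" "min_distance S r A = norm (r - A *v b)"
      using min_distance_attained[OF S] .
    with elim show ?case by force
  qed
  then have "(\<integral>A. 0 \<partial>(std_gaussian :: (real ^ 'm ^ 'n) measure)) < (\<integral>A. min_distance S r A \<partial>std_gaussian)"
    using integrable_min_distance[OF S, of r] emeasure_space_1
    by (intro integral_less_AE_space) auto
  then show ?thesis by simp
qed

text \<open>Multiplying by \<open>m\<close> undoes the normalization:
  \<open>m * ((c / m) / norm b) = 1\<close> because \<open>norm b = c\<close>. Rotation invariance
  then replaces \<open>m\<close> times the reference unit vector by an arbitrary \<open>r\<close> of
  norm \<open>m\<close>, which also makes the index \<open>i\<close> immaterial.\<close>

lemma code_gamma_min_distance:
  fixes A :: "'w \<Rightarrow> real ^ 'm::finite ^ 'n::finite" and r :: "real ^ 'n"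
  assumes A: "iid_std_normal_matrix M A" and S: "finite S" "S \<noteq> {}"
    and c: "\<And>b. b \<in> S \<Longrightarrow> norm b = c" "c > 0" and m: "m > 0" and r: "norm r = m"
  shows "m * code_gamma M A i S (c / m) = (\<integral>B. min_distance S r B \<partial>std_gaussian)"
proof -
  let ?e = "axis i 1 :: real ^ 'n"
  note [measurable] = iid_std_normal_matrix_distr(1)[OF A]
  have [measurable]: "(\<lambda>B :: real ^ 'm ^ 'n. min_distance S (m *\<^sub>R ?e) B) \<in> borel_measurable borel"
    using S(1) by measurable
  have eq: "m * Min ((\<lambda>b. norm (?e - ((c / m) / norm b) *\<^sub>R (B *v b))) ` S) = min_distance S (m *\<^sub>R ?e) B"
    for B :: "real ^ 'm ^ 'n"
  proof -
    have "m * Min ((\<lambda>b. norm (?e - ((c / m) / norm b) *\<^sub>R (B *v b))) ` S)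
        = Min ((*) m ` (\<lambda>b. norm (?e - ((c / m) / norm b) *\<^sub>R (B *v b))) ` S)"
      using S m by (intro mono_Min_commute) (auto intro!: monoI mult_left_mono)
    also have "(*) m ` (\<lambda>b. norm (?e - ((c / m) / norm b) *\<^sub>R (B *v b))) ` S
        = (\<lambda>b. norm (m *\<^sub>R ?e - B *v b)) ` S"
      unfolding image_image
    proof (rule image_cong[OF refl])
      fix b assume "b \<in> S"
      then have "m *\<^sub>R ?e - B *v b = m *\<^sub>R (?e - ((c / m) / norm b) *\<^sub>R (B *v b))"
        using c m by (simp add: algebra_simps)
      then show "m * norm (?e - ((c / m) / norm b) *\<^sub>R (B *v b)) = norm (m *\<^sub>R ?e - B *v b)"
        using m by simp
    qed
    finally show ?thesis unfolding min_distance_def .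
  qed
  have "m * code_gamma M A i S (c / m) = (\<integral>\<omega>. min_distance S (m *\<^sub>R ?e) (A \<omega>) \<partial>M)"
    unfolding code_gamma_def eq[symmetric] by simp
  also have "\<dots> = (\<integral>B. min_distance S (m *\<^sub>R ?e) B \<partial>distr M borel A)"
    by (rule integral_distr[symmetric]) measurable
  also have "\<dots> = (\<integral>B. min_distance S r B \<partial>std_gaussian)"
    unfolding iid_std_normal_matrix_distr(2)[OF A]
    by (rule integral_min_distance_cong_norm[OF S(1)]) (use m r in simp)
  finally show ?thesis .
qed

section \<open>Greedy encoding\<close>

text \<open>The orthogonal projection onto \<open>span S\<close>, built from an orthonormal basis.
  Symmetry and idempotence will make the mixing of two matrices orthogonal; the last two properties
  tell the current block from the blocks orthogonal to it.\<close>

lemma orthogonal_projection_exists: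
  fixes S :: "'a::euclidean_space set"
  obtains P :: "'a \<Rightarrow> 'a" where "linear P" "\<And>x y. P x \<bullet> y = x \<bullet> P y" "\<And>x. P (P x) = P x"
    "\<And>b. b \<in> S \<Longrightarrow> P b = b" "\<And>y. \<forall>b\<in>S. b \<bullet> y = 0 \<Longrightarrow> P y = 0"
proof -
  obtain U where U: "U \<subseteq> span S" "pairwise orthogonal U" "\<And>u. u \<in> U \<Longrightarrow> norm u = 1"
    "independent U" "span U = span S"
    using orthonormal_basis_subspace[OF subspace_span[of S]] by metis
  have fin: "finite U" using U(4) by (rule independent_imp_finite)
  define P where "P x = (\<Sum>u\<in>U. (u \<bullet> x) *\<^sub>R u)" for x
  have lin: "linear P"
    unfolding P_def
    by (rule linearI) (simp_all add: inner_add_right scaleR_add_left sum.distrib scaleR_sum_right)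
  have self: "P x \<bullet> y = x \<bullet> P y" for x y
    unfolding P_def by (simp add: inner_sum_left inner_sum_right inner_commute mult.commute)
  have PU: "P v = v" if "v \<in> U" for v
  proof -
    have "P v = (\<Sum>u\<in>U. if u = v then v else 0)"
      unfolding P_def
    proof (rule sum.cong[OF refl])
      fix u assume "u \<in> U"
      show "(u \<bullet> v) *\<^sub>R u = (if u = v then v else 0)"
        using U(2,3) that \<open>u \<in> U\<close>
        by (cases "u = v") (auto simp: pairwise_def orthogonal_def norm_eq_1)
    qed
    then show ?thesis using fin that by simp
  qed
  have P_span: "P v = v" if "v \<in> span S" for v
  proof -
    have "v \<in> span U" using that U(5) by simp
    then show ?thesis
      by (rule linear_eq_on[OF lin linear_ident]) (rule PU)
  qed
  show thesis
  proof
    show "linear P" by (rule lin)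
    show "P x \<bullet> y = x \<bullet> P y" for x y by (rule self)
    show "P b = b" if "b \<in> S" for b using that by (intro P_span span_base)
    have "P x \<in> span S" for x
      unfolding P_def using U(1) by (intro span_sum span_scale) auto
    then show "P (P x) = P x" for x by (rule P_span)
    show "P y = 0" if y: "\<forall>b\<in>S. b \<bullet> y = 0" for y
    proof -
      have "orthogonal y u" if "u \<in> U" for u
        using orthogonal_to_span[of u S y] U(1) that y
        by (auto simp: orthogonal_def inner_commute)
      then show ?thesis unfolding P_def by (simp add: orthogonal_def inner_commute)
    qed
  qed
qed

definition mix_rows ::
    "(real ^ 'm::finite \<Rightarrow> real ^ 'm) \<Rightarrow> real ^ 'm ^ 'n::finite \<Rightarrow> real ^ 'm ^ 'n \<Rightarrow> real ^ 'm ^ 'n" where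
  "mix_rows P A A' = (\<chi> i. P (A $ i) + (A' $ i - P (A' $ i)))"

text \<open>The map \<open>(A, A') \<mapsto> (AP + A'(1 - P), A'P + A(1 - P))\<close> is orthogonal; this replaces the
  independence of the Gaussian vectors \<open>Ab\<close> attached to orthogonal blocks.\<close>

lemma distr_mix_rows:
  fixes P :: "real ^ 'm::finite \<Rightarrow> real ^ 'm"
  assumes lin: "linear P" and self: "\<And>x y. P x \<bullet> y = x \<bullet> P y" and idem: "\<And>x. P (P x) = P x"
  shows "(\<lambda>(A, A'). mix_rows P A A') \<in> borel_measurable
      ((std_gaussian :: (real ^ 'm ^ 'n::finite) measure) \<Otimes>\<^sub>M std_gaussian)"
    and "distr (std_gaussian \<Otimes>\<^sub>M std_gaussian) borel (\<lambda>(A, A'). mix_rows P A A')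
      = (std_gaussian :: (real ^ 'm ^ 'n) measure)"
proof -
  let ?G = "std_gaussian :: (real ^ 'm ^ 'n) measure"
  interpret prob_space ?G by (rule prob_space_std_gaussian)
  \<comment> \<open>The second component serves only to complete the mixing to a norm-preserving map
    of pairs; it is projected away at the end.\<close>
  define T :: "(real ^ 'm ^ 'n) \<times> (real ^ 'm ^ 'n) \<Rightarrow> _"
    where "T z = (mix_rows P (fst z) (snd z), mix_rows P (snd z) (fst z))" for z
  have orth: "(a - P a) \<bullet> P b = 0" "P b \<bullet> (a - P a) = 0" for a b
    using self[of "a - P a" b] by (simp_all add: linear_diff[OF lin] idem inner_commute)
  \<comment> \<open>Pythagoras for the two mixed rows and, with equal arguments, for the
    decompositions of \<open>a\<close> and \<open>a'\<close> themselves.\<close>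
  have row: "(norm (P a + (a' - P a')))\<^sup>2 + (norm (P a' + (a - P a)))\<^sup>2 = (norm a)\<^sup>2 + (norm a')\<^sup>2" for a a'
  proof -
    have "(norm (P a + (a' - P a')))\<^sup>2 = (norm (P a))\<^sup>2 + (norm (a' - P a'))\<^sup>2" for a a'
      unfolding power2_norm_eq_inner by (simp add: inner_add_left inner_add_right orth)
    from this[of a a'] this[of a' a] this[of a a] this[of a' a'] show ?thesis by simp
  qed
  have rows: "(norm A)\<^sup>2 = (\<Sum>i\<in>UNIV. (norm (A $ i))\<^sup>2)" for A :: "real ^ 'm ^ 'n"
    unfolding power2_norm_eq_inner by (rule inner_vec_def)
  have T: "orthogonal_transformation T"
    unfolding orthogonal_transformation
  proof (intro conjI allI)
    show "linear T"
      by (rule linearI)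
        (auto simp: T_def mix_rows_def vec_eq_iff linear_add[OF lin] linear_cmul[OF lin] algebra_simps)
    fix z
    have "(norm (T z))\<^sup>2 = (norm z)\<^sup>2"
      by (cases z) (simp add: T_def norm_Pair rows mix_rows_def row sum.distrib[symmetric])
    then show "norm (T z) = norm z" by simp
  qed
  note Tm = borel_measurable_orthogonal_transformation[OF T]
  have fm [measurable]: "fst \<in> borel_measurable (borel :: ((real ^ 'm ^ 'n) \<times> (real ^ 'm ^ 'n)) measure)"
    by (intro borel_measurable_continuous_onI continuous_on_fst continuous_on_id)
  have eq: "(\<lambda>(A, A'). mix_rows P A A') = fst \<circ> T" by (auto simp: T_def fun_eq_iff)
  have TG: "T \<in> borel_measurable (?G \<Otimes>\<^sub>M ?G)"
    using Tm by (simp add: std_gaussian_pair measurable_cong_sets[OF sets_std_gaussian refl])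
  show "(\<lambda>(A, A'). mix_rows P A A') \<in> borel_measurable (?G \<Otimes>\<^sub>M ?G)"
    unfolding eq by (rule measurable_comp[OF TG fm])
  have "distr (?G \<Otimes>\<^sub>M ?G) borel (\<lambda>(A, A'). mix_rows P A A') = distr (distr (?G \<Otimes>\<^sub>M ?G) borel T) borel fst"
    unfolding eq by (rule distr_distr[OF fm TG, symmetric])
  also have "distr (?G \<Otimes>\<^sub>M ?G) borel T = ?G \<Otimes>\<^sub>M ?G"
    unfolding std_gaussian_pair by (rule distr_std_gaussian_orthogonal_transformation[OF T])
  also have "distr (?G \<Otimes>\<^sub>M ?G) borel fst = ?G"
  proof (rule measure_eqI)
    fix X assume "X \<in> sets (distr (?G \<Otimes>\<^sub>M ?G) borel fst)"
    then have X: "X \<in> sets ?G" by simp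
    have "fst -` X \<inter> space (?G \<Otimes>\<^sub>M ?G) = X \<times> space ?G" by (auto simp: space_pair_measure)
    then show "emeasure (distr (?G \<Otimes>\<^sub>M ?G) borel fst) X = emeasure ?G X"
      using X emeasure_pair_measure_Times[OF X, of "space ?G"] emeasure_space_1
      by (subst emeasure_distr) (auto simp: measurable_cong_sets[OF refl sets_std_gaussian[symmetric]])
  qed simp
  finally show "distr (?G \<Otimes>\<^sub>M ?G) borel (\<lambda>(A, A'). mix_rows P A A') = ?G" .
qed

text \<open>Symmetry moves \<open>P\<close> from the rows onto \<open>b\<close>. The current block
  will thus see only \<open>A\<close>, and the earlier blocks only \<open>A'\<close>.\<close>

lemma mix_rows_mult:
  fixes A :: "real ^ 'm::finite ^ 'n::finite"
  assumes self: "\<And>x y. P x \<bullet> y = x \<bullet> P y"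
  shows "P b = b \<Longrightarrow> mix_rows P A A' *v b = A *v b" "P b = 0 \<Longrightarrow> mix_rows P A A' *v b = A' *v b"
proof -
  have "mix_rows P A A' *v b = (\<chi> i. A $ i \<bullet> P b + (A' $ i \<bullet> b - A' $ i \<bullet> P b))"
    by (simp add: vec_eq_iff mix_rows_def matrix_vector_mul_component inner_add_left inner_diff_left self)
  moreover have "C *v b = (\<chi> i. C $ i \<bullet> b)" for C :: "real ^ 'm ^ 'n"
    by (simp add: vec_eq_iff matrix_vector_mul_component)
  ultimately show "P b = b \<Longrightarrow> mix_rows P A A' *v b = A *v b" "P b = 0 \<Longrightarrow> mix_rows P A A' *v b = A' *v b"
    by simp_all
qed

section \<open>How the encoder depends on the matrix\<close>

lemma distance_selection_arg_min:
  assumes "distance_selection S s"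
  shows "is_arg_min (\<lambda>b. norm (r - restrict y S b)) (\<lambda>b. b \<in> S) (s r (restrict y S))"
  using assms restrict_extensional unfolding distance_selection_def by blast

lemma distance_selection_mem: "distance_selection S s \<Longrightarrow> s r (restrict y S) \<in> S"
  using distance_selection_arg_min[of S s r y] unfolding is_arg_min_def by blast

text \<open>A step reads the matrix only through the residual and the images of its own block; here
  it matters that the selection rule receives no more than that. The second conjunct is carried
  along because it keeps the residuals equal in the induction.\<close>

lemma greedy_beta_cong:
  assumes "\<And>k b. k \<in> {1..l} \<Longrightarrow> b \<in> B k \<Longrightarrow> A *v b = A' *v b"
    and "\<And>k. k \<in> {1..l} \<Longrightarrow> distance_selection (B k) (s k)"
  shows "greedy_beta B s x A l = greedy_beta B s x A' l
    \<and> A *v greedy_beta B s x A l = A' *v greedy_beta B s x A' l"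
  using assms
proof (induction l)
  case 0
  then show ?case by simp
next
  case (Suc l)
  let ?r = "x - A *v greedy_beta B s x A l" and ?y = "restrict (\<lambda>b. A *v b) (B (Suc l))"
  have IH: "greedy_beta B s x A l = greedy_beta B s x A' l
    \<and> A *v greedy_beta B s x A l = A' *v greedy_beta B s x A' l"
  proof (rule Suc.IH)
    show "A *v b = A' *v b" if "k \<in> {1..l}" "b \<in> B k" for k b
      using Suc.prems(1)[of k b] that by simp
    show "distance_selection (B k) (s k)" if "k \<in> {1..l}" for k
      using Suc.prems(2)[of k] that by simp
  qed
  have y: "?y = restrict (\<lambda>b. A' *v b) (B (Suc l))"
    using Suc.prems(1)[of "Suc l"] by (auto simp: restrict_def)
  \<comment> \<open>The two matrices agree only on codewords, so the selected vector has to be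
    one.\<close>
  have "s (Suc l) ?r ?y \<in> B (Suc l)"
    by (rule distance_selection_mem[OF Suc.prems(2)]) simp
  then have "A *v s (Suc l) ?r ?y = A' *v s (Suc l) ?r ?y"
    using Suc.prems(1)[of "Suc l"] by auto
  moreover have "greedy_beta B s x A' (Suc l) = greedy_beta B s x A' l + s (Suc l) ?r ?y"
    using IH unfolding greedy_beta.simps y by metis
  ultimately show ?case
    using IH by (metis greedy_beta.simps(2) matrix_vector_right_distrib)
qed

lemma greedy_residual_mix_rows:
  assumes self: "\<And>x y. P x \<bullet> y = x \<bullet> P y"
    and "\<And>k b. k \<in> {1..l} \<Longrightarrow> b \<in> B k \<Longrightarrow> P b = 0"
    and "\<And>k. k \<in> {1..l} \<Longrightarrow> distance_selection (B k) (s k)"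
  shows "greedy_residual B s x (mix_rows P A A') l = greedy_residual B s x A' l"
proof -
  have "mix_rows P A A' *v b = A' *v b" if "k \<in> {1..l}" "b \<in> B k" for k b
    using assms(2)[OF that] by (rule mix_rows_mult(2)[OF self])
  then have "greedy_beta B s x (mix_rows P A A') l = greedy_beta B s x A' l
    \<and> mix_rows P A A' *v greedy_beta B s x (mix_rows P A A') l = A' *v greedy_beta B s x A' l"
    using assms(3) by (rule greedy_beta_cong)
  then show ?thesis unfolding greedy_residual_def by metis
qed

text \<open>All minimizers attain the same distance, so the tie-breaking rule drops out of the new
  norm.\<close>

lemma norm_greedy_residual_Suc:
  assumes "distance_selection (B (Suc l)) (s (Suc l))" "finite (B (Suc l))"
  shows "norm (greedy_residual B s x A (Suc l)) = min_distance (B (Suc l)) (greedy_residual B s x A l) A"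
proof -
  let ?r = "greedy_residual B s x A l" and ?S = "B (Suc l)"
  let ?y = "restrict (\<lambda>b. A *v b) ?S"
  let ?b = "s (Suc l) ?r ?y"
  have arg: "is_arg_min (\<lambda>b. norm (?r - ?y b)) (\<lambda>b. b \<in> ?S) ?b"
    by (rule distance_selection_arg_min[OF assms(1)])
  then have le: "norm (?r - A *v ?b) \<le> norm (?r - A *v b)" if "b \<in> ?S" for b
    using that by (auto simp: is_arg_min_def not_less)
  have b: "?b \<in> ?S" using arg by (auto simp: is_arg_min_def)
  have "greedy_residual B s x A (Suc l) = ?r - A *v ?b"
    by (simp add: greedy_residual_def matrix_vector_right_distrib)
  moreover have "min_distance ?S ?r A = norm (?r - A *v ?b)"
    unfolding min_distance_def using assms(2) b le by (intro Min_eqI) auto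
  ultimately show ?thesis by simp
qed

lemma borel_measurable_greedy_residual:
  fixes B :: "nat \<Rightarrow> (real ^ 'm::finite) set" and x :: "real ^ 'n::finite"
  assumes "\<And>k. k \<in> {1..l} \<Longrightarrow> distance_selection (B k) (s k)"
  shows "(\<lambda>A. greedy_residual B s x A l) \<in> borel_measurable borel"
  using assms
proof (induction l)
  case 0
  then show ?case by (simp add: greedy_residual_def)
next
  case (Suc l)
  let ?S = "B (Suc l)"
  have r [measurable]: "(\<lambda>A. greedy_residual B s x A l) \<in> borel_measurable borel"
    using Suc by auto
  have y: "(\<lambda>A :: real ^ 'm ^ 'n. restrict (\<lambda>b. A *v b) ?S) \<in> borel \<rightarrow>\<^sub>M PiM ?S (\<lambda>_. borel)"
    by (intro measurable_restrict borel_measurable_continuous_onI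
        linear_continuous_on[OF bounded_linear_matrix_vector_mult_left])
  have s: "(\<lambda>(r, y). s (Suc l) r y) \<in> borel_measurable (borel \<Otimes>\<^sub>M PiM ?S (\<lambda>_. borel))"
    using Suc.prems[of "Suc l"] by (simp add: distance_selection_def)
  have b [measurable]: "(\<lambda>A. s (Suc l) (greedy_residual B s x A l) (restrict (\<lambda>b. A *v b) ?S)) \<in> borel_measurable borel"
    using measurable_compose[OF measurable_Pair[OF r y] s] by simp
  \<comment> \<open>The selected codeword varies with \<open>A\<close>, so linearity in the matrix
    for a fixed vector is not enough.\<close>
  have "continuous_on UNIV (\<lambda>z :: (real ^ 'm ^ 'n) \<times> (real ^ 'm). fst z *v snd z)"
    unfolding matrix_vector_mult_def by (intro continuous_intros)
  from borel_measurable_continuous_Pair[where H="(*v)", OF measurable_ident_sets[OF refl] b this]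
  have "(\<lambda>A. A *v s (Suc l) (greedy_residual B s x A l) (restrict (\<lambda>b. A *v b) ?S)) \<in> borel_measurable borel"
    by simp
  moreover have "greedy_residual B s x A (Suc l)
      = greedy_residual B s x A l - A *v s (Suc l) (greedy_residual B s x A l) (restrict (\<lambda>b. A *v b) ?S)" for A
    by (simp add: greedy_residual_def matrix_vector_right_distrib)
  ultimately show ?case by simp
qed

text \<open>Inside the locale the matrix is distributed as \<open>std_gaussian\<close> itself; the
  probability space \<open>M\<close> returns only in the theorem.\<close>

locale greedy_code =
  fixes B :: "nat \<Rightarrow> (real ^ 'm::finite) set" and c :: "nat \<Rightarrow> real" and L :: nat
    and s :: "nat \<Rightarrow> real ^ 'n::finite \<Rightarrow> (real ^ 'm \<Rightarrow> real ^ 'n) \<Rightarrow> real ^ 'm"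
    and x :: "real ^ 'n"
  assumes code: "additive_orthogonal_code L B c"
    and selection: "\<And>l. l \<in> {1..L} \<Longrightarrow> distance_selection (B l) (s l)"
begin

abbreviation gauss :: "(real ^ 'm ^ 'n) measure" where "gauss \<equiv> std_gaussian"

abbreviation res :: "nat \<Rightarrow> real ^ 'm ^ 'n \<Rightarrow> real ^ 'n" where
  "res l A \<equiv> greedy_residual B s x A l"

definition mean_res :: "nat \<Rightarrow> real" where
  "mean_res l = (\<integral>A. norm (res l A) \<partial>gauss)"

definition var_res :: "nat \<Rightarrow> real" where
  "var_res l = (\<integral>A. (norm (res l A) - mean_res l)\<^sup>2 \<partial>gauss)"

section \<open>Mean and variance of the residual norms\<close>

lemma block:
  assumes "l \<in> {1..L}"
  shows "finite (B l)" "B l \<noteq> {}" "c l > 0" "\<And>b. b \<in> B l \<Longrightarrow> norm b = c l"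
  using code assms unfolding additive_orthogonal_code_def by auto

lemma block_orthogonal:
  "k \<in> {1..L} \<Longrightarrow> l \<in> {1..L} \<Longrightarrow> k \<noteq> l \<Longrightarrow> b \<in> B k \<Longrightarrow> b' \<in> B l \<Longrightarrow> b \<bullet> b' = 0"
  using code unfolding additive_orthogonal_code_def by blast

lemma borel_measurable_res [measurable]: "l \<le> L \<Longrightarrow> res l \<in> borel_measurable borel"
  by (rule borel_measurable_greedy_residual) (use selection in auto)

lemma norm_res_Suc:
  "Suc l \<le> L \<Longrightarrow> norm (res (Suc l) A) = min_distance (B (Suc l)) (res l A) A"
  by (intro norm_greedy_residual_Suc selection block) auto

lemma norm_res_le: "l \<le> L \<Longrightarrow> norm (res l A) \<le> norm x + (\<Sum>k=1..l. c k) * norm A"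
proof (induction l)
  case 0
  then show ?case by (simp add: greedy_residual_def)
next
  case (Suc l)
  have l: "Suc l \<in> {1..L}" using Suc by auto
  have "norm (res (Suc l) A) \<le> norm (res l A) + c (Suc l) * norm A"
    unfolding norm_res_Suc[OF Suc.prems]
    using block[OF l] by (intro min_distance_le_norm) auto
  then show ?case using Suc by (simp add: algebra_simps)
qed

lemma integrable_norm_res:
  assumes "l \<le> L"
  shows "integrable gauss (\<lambda>A. norm (res l A))" "integrable gauss (\<lambda>A. (norm (res l A))\<^sup>2)"
proof -
  have "\<bar>norm (res l A)\<bar> \<le> norm x + (\<Sum>k=1..l. c k) * norm A" for A
    using norm_res_le[OF assms] by simp
  moreover have "(\<lambda>A. norm (res l A)) \<in> borel_measurable borel"
    using borel_measurable_res[OF assms] by measurable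
  ultimately show "integrable gauss (\<lambda>A. norm (res l A))" "integrable gauss (\<lambda>A. (norm (res l A))\<^sup>2)"
    by (rule integrable_std_gaussian_linear_growth[rotated])+
qed

lemma integrable_norm_res_diff_square:
  "l \<le> L \<Longrightarrow> integrable gauss (\<lambda>A. (norm (res l A) - a)\<^sup>2)"
proof -
  assume l: "l \<le> L"
  interpret prob_space gauss by (rule prob_space_std_gaussian)
  show ?thesis using integrable_norm_res[OF l] unfolding power2_diff by auto
qed

text \<open>Conditioning on the residual: in the next encoding step the matrix may be replaced by an
  independent copy.\<close>

lemma integral_norm_res_Suc:
  fixes f :: "real \<Rightarrow> real"
  assumes l: "Suc l \<le> L" and [measurable]: "f \<in> borel_measurable borel"
    and int: "integrable gauss (\<lambda>A. f (norm (res (Suc l) A)))"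
  shows "integrable gauss (\<lambda>A'. \<integral>A. f (min_distance (B (Suc l)) (res l A') A) \<partial>gauss)"
    and "(\<integral>A. f (norm (res (Suc l) A)) \<partial>gauss)
      = (\<integral>A'. (\<integral>A. f (min_distance (B (Suc l)) (res l A') A) \<partial>gauss) \<partial>gauss)"
proof -
  interpret prob_space gauss by (rule prob_space_std_gaussian)
  interpret GG: pair_sigma_finite gauss gauss ..
  let ?S = "B (Suc l)"
  have Sl: "Suc l \<in> {1..L}" using l by auto
  \<comment> \<open>\<open>P\<close> fixes the current block and, the blocks being orthogonal,
    annihilates the earlier ones. For the mixed matrix the residual after \<open>l\<close> steps is
    therefore that of \<open>A'\<close>, while the next block meets the independent
    \<open>A\<close>.\<close>
  obtain P :: "real ^ 'm \<Rightarrow> real ^ 'm" where P: "linear P" "\<And>x y. P x \<bullet> y = x \<bullet> P y" "\<And>x. P (P x) = P x"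
    and PS: "\<And>b. b \<in> ?S \<Longrightarrow> P b = b"
    and P0: "\<And>y. \<forall>b\<in>?S. b \<bullet> y = 0 \<Longrightarrow> P y = 0"
    by (rule orthogonal_projection_exists[of ?S]) (rule that)
  note mix = distr_mix_rows[OF P, where 'n='n]
  have res_mix: "res l (mix_rows P A A') = res l A'" for A A'
  proof (rule greedy_residual_mix_rows[OF P(2)])
    fix k b assume k: "k \<in> {1..l}" and b: "b \<in> B k"
    show "P b = 0"
      using k l by (intro P0 ballI block_orthogonal[OF Sl _ _ _ b]) auto
  next
    show "distance_selection (B k) (s k)" if "k \<in> {1..l}" for k
      using that l by (intro selection) auto
  qed
  have "min_distance ?S r (mix_rows P A A') = min_distance ?S r A" for r and A A' :: "real ^ 'm ^ 'n"
    unfolding min_distance_def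
    by (intro arg_cong[where f=Min] image_cong refl) (simp add: mix_rows_mult(1)[OF P(2) PS])
  then have eq: "norm (res (Suc l) (mix_rows P A A')) = min_distance ?S (res l A') A" for A A'
    by (simp add: norm_res_Suc[OF l] res_mix)
  have fm: "(\<lambda>A. f (norm (res (Suc l) A))) \<in> borel_measurable borel"
    using borel_measurable_res[OF l] by measurable
  have i: "integrable (gauss \<Otimes>\<^sub>M gauss) (\<lambda>(A, A'). f (min_distance ?S (res l A') A))"
    using int integrable_distr_eq[OF mix(1) fm] unfolding mix(2)
    by (simp add: eq case_prod_unfold)
  show "integrable gauss (\<lambda>A'. \<integral>A. f (min_distance ?S (res l A') A) \<partial>gauss)"
    using GG.integrable_snd[OF i] by simp
  have "(\<integral>A. f (norm (res (Suc l) A)) \<partial>gauss)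
      = (\<integral>z. f (norm (res (Suc l) (case z of (A, A') \<Rightarrow> mix_rows P A A'))) \<partial>(gauss \<Otimes>\<^sub>M gauss))"
    using integral_distr[OF mix(1) fm] unfolding mix(2) .
  also have "\<dots> = (\<integral>z. (case z of (A, A') \<Rightarrow> f (min_distance ?S (res l A') A)) \<partial>(gauss \<Otimes>\<^sub>M gauss))"
    by (simp add: eq case_prod_beta)
  also have "\<dots> = (\<integral>A'. (\<integral>A. f (min_distance ?S (res l A') A) \<partial>gauss) \<partial>gauss)"
    by (rule GG.integral_snd[OF i, symmetric])
  finally show "(\<integral>A. f (norm (res (Suc l) A)) \<partial>gauss)
      = (\<integral>A'. (\<integral>A. f (min_distance ?S (res l A') A) \<partial>gauss) \<partial>gauss)" .
qed

text \<open>Variance decomposition given the previous residual. The conditional variance is at most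
  \<open>(c (Suc l))\<^sup>2\<close> by the Poincare inequality; the conditional mean is a
  1-Lipschitz function of the previous norm, so the earlier variance is passed on without
  amplification.\<close>

lemma var_res_Suc_le:
  assumes l: "Suc l \<le> L"
  shows "var_res (Suc l) \<le> (c (Suc l))\<^sup>2 + var_res l"
proof -
  interpret prob_space gauss by (rule prob_space_std_gaussian)
  let ?S = "B (Suc l)"
  let ?g = "\<lambda>r. \<integral>A. min_distance ?S r A \<partial>gauss"
  have Sl: "Suc l \<in> {1..L}" using l by auto
  have l': "l \<le> L" using l by simp
  note S = block(1,2)[OF Sl]
  obtain u :: "real ^ 'n" where u: "norm u = \<bar>mean_res l\<bar>"
    using vector_choose_size[of "\<bar>mean_res l\<bar>"] by auto
  have m0: "0 \<le> mean_res l"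
    unfolding mean_res_def by (intro Bochner_Integration.integral_nonneg) auto
  \<comment> \<open>The conditional mean at a residual of norm \<open>mean_res l\<close>, in general
    not the mean of the new norm. Centering here can only increase the second moment, and it makes
    the Lipschitz bound directly applicable.\<close>
  define a where "a = ?g u"
  have inner: "(\<integral>A. (min_distance ?S r A - a)\<^sup>2 \<partial>gauss) \<le> (c (Suc l))\<^sup>2 + (norm r - mean_res l)\<^sup>2" for r
  proof -
    note i = integrable_min_distance[OF S, of r]
    have "(\<integral>A. (min_distance ?S r A - a)\<^sup>2 \<partial>gauss)
        = (\<integral>A. (min_distance ?S r A - ?g r)\<^sup>2 + 2 * (?g r - a) * (min_distance ?S r A - ?g r) + (?g r - a)\<^sup>2 \<partial>gauss)"
      by (intro Bochner_Integration.integral_cong refl) (simp add: power2_eq_square algebra_simps)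
    also have "\<dots> = (\<integral>A. (min_distance ?S r A - ?g r)\<^sup>2 \<partial>gauss) + (?g r - a)\<^sup>2"
    proof -
      have "integrable gauss (\<lambda>A. (min_distance ?S r A - ?g r)\<^sup>2)"
        using i unfolding power2_diff by auto
      then show ?thesis using i prob_space by simp
    qed
    also have "(\<integral>A. (min_distance ?S r A - ?g r)\<^sup>2 \<partial>gauss) \<le> (c (Suc l))\<^sup>2"
      by (rule variance_min_distance_le[OF S]) (simp add: block(4)[OF Sl])
    also have "(?g r - a)\<^sup>2 \<le> (norm r - mean_res l)\<^sup>2"
      using integral_min_distance_lipschitz[OF S, of r u] u m0
      unfolding a_def by (intro abs_le_square_iff[THEN iffD1]) simp
    finally show ?thesis by simp
  qed
  have "var_res (Suc l) \<le> (\<integral>A. (norm (res (Suc l) A) - a)\<^sup>2 \<partial>gauss)"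
  proof -
    note i = integrable_norm_res[OF l]
    have "(\<integral>A. (norm (res (Suc l) A) - a)\<^sup>2 \<partial>gauss)
        = (\<integral>A. (norm (res (Suc l) A) - mean_res (Suc l))\<^sup>2
            + 2 * (mean_res (Suc l) - a) * (norm (res (Suc l) A) - mean_res (Suc l))
            + (mean_res (Suc l) - a)\<^sup>2 \<partial>gauss)"
      by (intro Bochner_Integration.integral_cong refl) (simp add: power2_eq_square algebra_simps)
    also have "\<dots> = var_res (Suc l) + (mean_res (Suc l) - a)\<^sup>2"
      using i integrable_norm_res_diff_square[OF l, of "mean_res (Suc l)"] prob_space
      by (simp add: var_res_def mean_res_def)
    finally show ?thesis by simp
  qed
  also have "\<dots> = (\<integral>A'. (\<integral>A. (min_distance ?S (res l A') A - a)\<^sup>2 \<partial>gauss) \<partial>gauss)"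
    by (rule integral_norm_res_Suc(2)[OF l, of "\<lambda>t. (t - a)\<^sup>2"])
      (auto intro: integrable_norm_res_diff_square[OF l])
  also have "\<dots> \<le> (\<integral>A'. (c (Suc l))\<^sup>2 + (norm (res l A') - mean_res l)\<^sup>2 \<partial>gauss)"
  proof (rule integral_mono[OF _ _ inner])
    show "integrable gauss (\<lambda>A'. \<integral>A. (min_distance ?S (res l A') A - a)\<^sup>2 \<partial>gauss)"
      by (rule integral_norm_res_Suc(1)[OF l, of "\<lambda>t. (t - a)\<^sup>2"])
        (auto intro: integrable_norm_res_diff_square[OF l])
    show "integrable gauss (\<lambda>A'. (c (Suc l))\<^sup>2 + (norm (res l A') - mean_res l)\<^sup>2)"
      using integrable_norm_res_diff_square[OF l'] by auto
  qed
  also have "\<dots> = (c (Suc l))\<^sup>2 + var_res l"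
    using integrable_norm_res_diff_square[OF l', of "mean_res l"] prob_space
    by (simp add: var_res_def)
  finally show ?thesis .
qed

lemma var_res_le: "l \<le> L \<Longrightarrow> var_res l \<le> (\<Sum>k=1..l. (c k)\<^sup>2)"
proof (induction l)
  case 0
  interpret prob_space gauss by (rule prob_space_std_gaussian)
  show ?case using prob_space by (simp add: var_res_def mean_res_def greedy_residual_def)
next
  case (Suc l)
  then show ?case using var_res_Suc_le[of l] by simp
qed

text \<open>Only the initial residual needs \<open>x \<noteq> 0\<close>. In later steps the
  conditional mean is positive for every previous residual, even a zero one, because codewords are
  nonzero and their images almost surely miss a given point.\<close>

lemma mean_res_pos:
  assumes "x \<noteq> 0" "l \<le> L"
  shows "0 < mean_res l"
proof (cases l)
  case 0
  interpret prob_space gauss by (rule prob_space_std_gaussian)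
  show ?thesis using 0 prob_space assms by (simp add: mean_res_def greedy_residual_def)
next
  case (Suc k)
  interpret prob_space gauss by (rule prob_space_std_gaussian)
  have k: "Suc k \<le> L" and Sk: "Suc k \<in> {1..L}" using Suc assms by auto
  note int = integrable_norm_res(1)[OF k]
  note step = integral_norm_res_Suc[OF k, of "\<lambda>t. t", OF measurable_ident_sets[OF refl] int]
  have "0 \<notin> B (Suc k)" using block(3,4)[OF Sk] by force
  then have "0 < (\<integral>A. min_distance (B (Suc k)) (res k A') A \<partial>gauss)" for A'
    using block(1,2)[OF Sk] by (intro integral_min_distance_pos)
  then have "(\<integral>A'. 0 \<partial>gauss) < (\<integral>A'. (\<integral>A. min_distance (B (Suc k)) (res k A') A \<partial>gauss) \<partial>gauss)"
    using step(1) emeasure_space_1 by (intro integral_less_AE_space) auto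
  then show ?thesis using step(2) Suc by (simp add: mean_res_def)
qed

lemma mean_res_step:
  assumes l: "Suc l \<le> L" and u: "norm u = mean_res l"
  shows "\<bar>mean_res (Suc l) - (\<integral>A. min_distance (B (Suc l)) u A \<partial>gauss)\<bar> \<le> sqrt (\<Sum>k=1..l. (c k)\<^sup>2)"
proof -
  interpret prob_space gauss by (rule prob_space_std_gaussian)
  have l': "l \<le> L" and Sl: "Suc l \<in> {1..L}" using l by auto
  let ?g = "\<lambda>r. \<integral>A. min_distance (B (Suc l)) r A \<partial>gauss"
  let ?d = "\<lambda>A. \<bar>norm (res l A) - mean_res l\<bar>"
  note step = integral_norm_res_Suc[OF l, of "\<lambda>t. t", OF measurable_ident_sets[OF refl] integrable_norm_res(1)[OF l]]
  have id: "integrable gauss ?d" using integrable_norm_res(1)[OF l'] by auto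
  have "\<bar>mean_res (Suc l) - ?g u\<bar> = \<bar>\<integral>A'. ?g (res l A') - ?g u \<partial>gauss\<bar>"
    unfolding mean_res_def[of "Suc l"] step(2) using step(1) prob_space by simp
  also have "\<dots> \<le> (\<integral>A'. \<bar>?g (res l A') - ?g u\<bar> \<partial>gauss)"
    by (rule integral_abs_bound)
  also have "\<dots> \<le> (\<integral>A'. ?d A' \<partial>gauss)"
    using step(1) id integral_min_distance_lipschitz[OF block(1,2)[OF Sl], of _ u] u
    by (intro integral_mono) auto
  also have "\<dots> \<le> sqrt (var_res l)"
  proof (rule real_le_rsqrt)
    \<comment> \<open>Mean absolute deviation against standard deviation: the variance of
      \<open>?d\<close> is nonnegative.\<close>
    define e where "e = (\<integral>A. ?d A \<partial>gauss)"
    have "0 \<le> (\<integral>A. (?d A - e)\<^sup>2 \<partial>gauss)" by (intro Bochner_Integration.integral_nonneg) auto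
    also have "\<dots> = (\<integral>A. (norm (res l A) - mean_res l)\<^sup>2 - 2 * e * ?d A + e\<^sup>2 \<partial>gauss)"
      by (intro Bochner_Integration.integral_cong refl) (simp add: power2_diff[of "?d _"])
    also have "\<dots> = var_res l - 2 * e * e + e\<^sup>2"
      using id integrable_norm_res_diff_square[OF l', of "mean_res l"] prob_space
      by (simp add: var_res_def e_def)
    finally show "e\<^sup>2 \<le> var_res l" by (simp add: power2_eq_square)
  qed
  also have "\<dots> \<le> sqrt (\<Sum>k=1..l. (c k)\<^sup>2)"
    using var_res_le[OF l'] by simp
  finally show ?thesis .
qed

end

section \<open>The recursion for the centerings\<close>

theorem theorem4:
  fixes M :: "'w measure"
    and A :: "'w \<Rightarrow> real ^ 'N::finite ^ 'n::finite"
    and B :: "nat \<Rightarrow> (real ^ 'N) set"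
    and c :: "nat \<Rightarrow> real"
    and L :: nat
    and s :: "nat \<Rightarrow> real ^ 'n \<Rightarrow> (real ^ 'N \<Rightarrow> real ^ 'n) \<Rightarrow> real ^ 'N"
    and \<sigma> :: real
    and x :: "real ^ 'n"
    and i\<^sub>1 :: 'n
  assumes code: "additive_orthogonal_code L B c"
    and gauss: "iid_std_normal_matrix M A"
    and selection: "\<And>l. l \<in> {1..L} \<Longrightarrow> distance_selection (B l) (s l)"
    and sigma: "\<sigma> > 0"
    and source: "norm x = sqrt (real CARD('n)) * \<sigma>"
  shows "let n = real CARD('n);
             D = deterministic_centering M A B s x;
             \<gamma> = (\<lambda>l. code_gamma M A i\<^sub>1 (B l))
         in D 0 = \<sigma>\<^sup>2 \<and>
            (\<exists>\<eta>. \<forall>l\<in>{1..L}.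
               sqrt (D l) = sqrt (D (l - 1)) * \<gamma> l (c l / sqrt (n * D (l - 1))) + \<eta> l / sqrt n \<and>
               \<bar>\<eta> l\<bar> \<le> sqrt (\<Sum>k = 1..l - 1. (c k)\<^sup>2))"
proof -
  interpret greedy_code B c L s x
    by standard (use code selection in auto)
  interpret M: prob_space M using gauss by (simp add: iid_std_normal_matrix_def)
  define n where "n = real CARD('n)"
  define D where "D = deterministic_centering M A B s x"
  have n: "n > 0" by (simp add: n_def)
  have "norm x > 0" using source sigma by simp
  then have x0: "x \<noteq> 0" by simp
  have D: "D l = (mean_res l)\<^sup>2 / n" if "l \<le> L" for l
  proof -
    note [measurable] = iid_std_normal_matrix_distr(1)[OF gauss] borel_measurable_res[OF that]
    have "(\<integral>\<omega>. norm (res l (A \<omega>)) \<partial>M) = (\<integral>C. norm (res l C) \<partial>distr M borel A)"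
      by (rule integral_distr[symmetric]) measurable
    then show ?thesis
      by (simp add: D_def deterministic_centering_def mean_res_def n_def
          iid_std_normal_matrix_distr(2)[OF gauss])
  qed
  have sqrt_D: "sqrt (D l) = mean_res l / sqrt n" if "l \<le> L" for l
    using D[OF that] mean_res_pos[OF x0 that] by (simp add: real_sqrt_divide)
  have sqrt_nD: "sqrt (n * D l) = mean_res l" if "l \<le> L" for l
    using D[OF that] mean_res_pos[OF x0 that] n by simp
  \<comment> \<open>Since \<open>sqrt (n * D l)\<close> is \<open>mean_res l\<close>, this is the
    gap in the recursion multiplied by \<open>sqrt n\<close>; only its bound remains to be shown.
    For \<open>l = 1\<close> the bounding sum is empty, so the first step is exact.\<close>
  define \<eta> where "\<eta> l = mean_res l - mean_res (l - 1) * code_gamma M A i\<^sub>1 (B l) (c l / mean_res (l - 1))" for l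
  have D0: "D 0 = \<sigma>\<^sup>2"
    using n source M.prob_space
    by (simp add: D_def deterministic_centering_def greedy_residual_def n_def power_mult_distrib)
  have step: "sqrt (D l) = sqrt (D (l - 1)) * code_gamma M A i\<^sub>1 (B l) (c l / sqrt (n * D (l - 1))) + \<eta> l / sqrt n
      \<and> \<bar>\<eta> l\<bar> \<le> sqrt (\<Sum>k = 1..l - 1. (c k)\<^sup>2)" if l: "l \<in> {1..L}" for l
  proof
    obtain k where k: "l = Suc k" "Suc k \<le> L" "k \<le> L" using l by (cases l) auto
    show "sqrt (D l) = sqrt (D (l - 1)) * code_gamma M A i\<^sub>1 (B l) (c l / sqrt (n * D (l - 1))) + \<eta> l / sqrt n"
      using k n by (simp add: sqrt_D sqrt_nD \<eta>_def field_simps)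
    \<comment> \<open>Any vector of norm \<open>mean_res k\<close> would serve: it represents a
      residual of mean length, at which gamma is evaluated.\<close>
    define u :: "real ^ 'n" where "u = mean_res k *\<^sub>R axis i\<^sub>1 1"
    have pos: "0 < mean_res k" using mean_res_pos[OF x0 k(3)] .
    then have u: "norm u = mean_res k" by (simp add: u_def)
    have "mean_res k * code_gamma M A i\<^sub>1 (B l) (c l / mean_res k) = (\<integral>C. min_distance (B l) u C \<partial>std_gaussian)"
      using block[OF l] pos u by (intro code_gamma_min_distance gauss) auto
    then show "\<bar>\<eta> l\<bar> \<le> sqrt (\<Sum>k = 1..l - 1. (c k)\<^sup>2)"
      using mean_res_step[OF k(2) u] k(1) by (simp add: \<eta>_def)
  qed
  show ?thesis
    unfolding Let_def n_def[symmetric] D_def[symmetric] using D0 step by blast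
qed

end
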